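(* Let $\kappa\in C^0(\mathbb R)\cap L^\infty(\mathbb R)$ with $0<\kappa_*\le\kappa\le\kappa^*$, and assume that $\kappa$ is Lipschitz continuous: $|\kappa(\zeta_1)-\kappa(\zeta_2)|\le L_\kappa|\zeta_1-\zeta_2|$ for all $\zeta_1,\zeta_2\in\mathbb R$. Let $g\in L^2(\Omega)$. Let $r\in(2,r_0)$ and $s$ satisfy $\frac1r+\frac1s=\frac12$, where $r_0$ and $C(r)$ are the Meyers constants of the context. Then there is a constant $C_{\boldsymbol w}$, depending on $\kappa_*,\kappa^*,L_\kappa,b_0,C_{\rm gn}$ (for the given $s$), such that: for all $z_1,z_2\in H^1_D$, if $u_j\in H^1_D$ ($j=1,2$) is the solution of $$\langle\kappa(z_j)\nabla u_j,\nabla\varphi\rangle=\langle g,\varphi\rangle\quad\text{for all }\varphi\in H^1_D,$$ then $$\|\nabla(u_1-u_2)\|\le C_{\boldsymbol w}C(r)\,\|g\|\,\|z_1-z_2\|^{2/s}\,\|\nabla(z_1-z_2)\|^{(s-2)/s}$$ and $$\|\kappa(z_1)\nabla u_1-\kappa(z_2)\nabla u_2\|\le C_{\boldsymbol w}C(r)\,\|g\|\,\|z_1-z_2\|^{2/s}\,\|\nabla(z_1-z_2)\|^{(s-2)/s}.$$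
   Context: $\Omega\subset\mathbb R^2$ is a bounded open set with Lipschitz boundary $\partial\Omega=\Gamma_D\cup\Gamma_N$, $\Gamma_D\cap\Gamma_N=\emptyset$, $\Gamma_D\neq\emptyset$. $\|\cdot\|$ and $\langle\cdot,\cdot\rangle$ are the norm and inner product of $L^2(\Omega)$; $\|\cdot\|_{k,p}$ is the norm of $W^k_p(\Omega)$ ($\|\cdot\|_{0,p}$ the $L^p$ norm) and $\|\cdot\|_1$ that of $H^1(\Omega)$. $H^1_D=\{w\in H^1(\Omega):w=0\text{ on }\Gamma_D\}$, and $b_0>0$ is a constant with $b_0\|u\|_1\le\|\nabla u\|\le\|u\|_1$ for all $u\in H^1_D$. $C_{\rm gn}$ is a constant (depending on $\Omega$) in the Gagliardo–Nirenberg inequality $\|u\|_{0,a}\le C_{\rm gn}\|u\|_{0,c}^{c/a}\|u\|_1^{1-c/a}$, $1\le c\le a<\infty$, $u\in H^1(\Omega)$. Meyers constants: $r_0\in(2,\infty]$ (depending only on $\kappa_*,\kappa^*,\Omega\cup\Gamma_N$) and, for $r\in[2,r_0)$, $C(r)$ (depending on $\kappa_*,\kappa^*,\Omega,r$) are such that for every measurable $z$ on $\Omega$, the solution $u\in H^1_D$ of $\langle\kappa(z)\nabla u,\nabla\varphi\rangle=\langle g,\varphi\rangle$ for all $\varphi\in H^1_D$ satisfies $\|u\|_{1,r}\le C(r)\|g\|$. *)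

theory Defs
  imports "HOL-Analysis.Analysis"
begin

section \<open>Lebesgue spaces\<close>

definition Lp_space :: "'a::euclidean_space set \<Rightarrow> real \<Rightarrow> ('a \<Rightarrow> 'b::euclidean_space) set"
  where "Lp_space \<Omega> p = {f \<in> borel_measurable (lebesgue_on \<Omega>).
           integrable (lebesgue_on \<Omega>) (\<lambda>x. norm (f x) powr p)}"

definition Lp_norm :: "'a::euclidean_space set \<Rightarrow> real \<Rightarrow> ('a \<Rightarrow> 'b::euclidean_space) \<Rightarrow> real"
  where "Lp_norm \<Omega> p f = (\<integral>x. norm (f x) powr p \<partial>lebesgue_on \<Omega>) powr (1 / p)"

definition L2_inner ::
    "'a::euclidean_space set \<Rightarrow> ('a \<Rightarrow> 'b::euclidean_space) \<Rightarrow> ('a \<Rightarrow> 'b) \<Rightarrow> real"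
  where "L2_inner \<Omega> f g = (\<integral>x. f x \<bullet> g x \<partial>lebesgue_on \<Omega>)"


section \<open>Weak gradients and Sobolev spaces\<close>

definition partial :: "'n::finite \<Rightarrow> (real^'n \<Rightarrow> real) \<Rightarrow> real^'n \<Rightarrow> real"
  where "partial i f x = frechet_derivative f (at x) (axis i 1)"

primrec C_k :: "nat \<Rightarrow> (real^'n::finite \<Rightarrow> real) \<Rightarrow> bool"
  where
    "C_k 0 f \<longleftrightarrow> continuous_on UNIV f"
  | "C_k (Suc k) f \<longleftrightarrow> (\<forall>x. f differentiable (at x)) \<and> (\<forall>i. C_k k (partial i f))"

definition test_function :: "(real^'n::finite) set \<Rightarrow> (real^'n \<Rightarrow> real) \<Rightarrow> bool"
  where "test_function \<Omega> \<phi> \<longleftrightarrow> (\<forall>k. C_k k \<phi>) \<and>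
           compact (closure {x. \<phi> x \<noteq> 0}) \<and> closure {x. \<phi> x \<noteq> 0} \<subseteq> \<Omega>"

definition locally_integrable ::
    "'a::euclidean_space set \<Rightarrow> ('a \<Rightarrow> 'b::euclidean_space) \<Rightarrow> bool"
  where "locally_integrable \<Omega> f \<longleftrightarrow>
           (\<forall>K. compact K \<and> K \<subseteq> \<Omega> \<longrightarrow> set_integrable lebesgue K f)"

definition has_weak_gradient ::
    "(real^'n::finite) set \<Rightarrow> (real^'n \<Rightarrow> real) \<Rightarrow> (real^'n \<Rightarrow> real^'n) \<Rightarrow> bool"
  where "has_weak_gradient \<Omega> u G \<longleftrightarrow>
           locally_integrable \<Omega> u \<and> locally_integrable \<Omega> G \<and>
           (\<forall>\<phi> i. test_function \<Omega> \<phi> \<longrightarrow>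
              (\<integral>x. u x * partial i \<phi> x \<partial>lebesgue_on \<Omega>) = - (\<integral>x. G x $ i * \<phi> x \<partial>lebesgue_on \<Omega>))"

text \<open>A representative of the weak gradient; for open \<open>\<Omega>\<close> it is determined up to a null set.\<close>

definition wgrad :: "(real^'n::finite) set \<Rightarrow> (real^'n \<Rightarrow> real) \<Rightarrow> real^'n \<Rightarrow> real^'n"
  where "wgrad \<Omega> u = (SOME G. has_weak_gradient \<Omega> u G)"

definition W1_space :: "(real^'n::finite) set \<Rightarrow> real \<Rightarrow> (real^'n \<Rightarrow> real) set"
  where "W1_space \<Omega> p = {u \<in> Lp_space \<Omega> p. \<exists>G \<in> Lp_space \<Omega> p. has_weak_gradient \<Omega> u G}"

definition W1_norm :: "(real^'n::finite) set \<Rightarrow> real \<Rightarrow> (real^'n \<Rightarrow> real) \<Rightarrow> real"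
  where "W1_norm \<Omega> p u =
           (Lp_norm \<Omega> p u powr p + (\<Sum>i\<in>UNIV. Lp_norm \<Omega> p (\<lambda>x. wgrad \<Omega> u x $ i) powr p)) powr (1 / p)"

abbreviation H1 :: "(real^'n::finite) set \<Rightarrow> (real^'n \<Rightarrow> real) set"
  where "H1 \<Omega> \<equiv> W1_space \<Omega> 2"

abbreviation H1_norm :: "(real^'n::finite) set \<Rightarrow> (real^'n \<Rightarrow> real) \<Rightarrow> real"
  where "H1_norm \<Omega> \<equiv> W1_norm \<Omega> 2"


section \<open>Lipschitz boundaries and traces\<close>

text \<open>Near each boundary point, \<open>\<Omega>\<close> is in suitably rotated coordinates the region above the
  graph of a Lipschitz function.\<close>

definition lipschitz_boundary :: "(real^2) set \<Rightarrow> bool"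
  where "lipschitz_boundary \<Omega> \<longleftrightarrow>
           (\<forall>p \<in> frontier \<Omega>. \<exists>e>0. \<exists>(T :: real^2 \<Rightarrow> real^2) \<gamma> L.
              orthogonal_transformation T \<and> L-lipschitz_on UNIV (\<gamma> :: real \<Rightarrow> real) \<and>
              \<Omega> \<inter> ball p e = {x \<in> ball p e. T x $ 2 > \<gamma> (T x $ 1)})"

text \<open>One-dimensional Hausdorff (outer) measure. Boundedness of the covering sets is required
  because \<open>diameter\<close> has no meaningful value on unbounded sets.\<close>

definition hausdorff_length :: "'a::metric_space set \<Rightarrow> ennreal"
  where "hausdorff_length A =
           (SUP \<delta> \<in> {0<..}. INF C \<in> {C :: nat \<Rightarrow> 'a set. A \<subseteq> (\<Union>i. C i) \<and>
                 (\<forall>i. bounded (C i) \<and> diameter (C i) \<le> \<delta>)}.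
              (\<Sum>i. ennreal (diameter (C i))))"

definition boundary_measure :: "(real^2) set \<Rightarrow> (real^2) measure"
  where "boundary_measure \<Omega> =
           restrict_space (measure_of UNIV (sets borel) hausdorff_length) (frontier \<Omega>)"

text \<open>The trace is the continuous extension to \<open>H\<^sup>1(\<Omega>)\<close>, with values in \<open>L\<^sup>2(\<partial>\<Omega>)\<close>, of the
  restriction to the boundary of the functions in \<open>H\<^sup>1(\<Omega>)\<close> that are continuous on the closure.\<close>

definition has_trace :: "(real^2) set \<Rightarrow> (real^2 \<Rightarrow> real) \<Rightarrow> (real^2 \<Rightarrow> real) \<Rightarrow> bool"
  where "has_trace \<Omega> w t \<longleftrightarrow>
           t \<in> borel_measurable (boundary_measure \<Omega>) \<and>
           integrable (boundary_measure \<Omega>) (\<lambda>x. (t x)\<^sup>2) \<and>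
           (\<exists>W :: nat \<Rightarrow> real^2 \<Rightarrow> real.
              (\<forall>n. W n \<in> H1 \<Omega> \<and> continuous_on (closure \<Omega>) (W n)) \<and>
              (\<lambda>n. H1_norm \<Omega> (\<lambda>x. W n x - w x)) \<longlonglongrightarrow> 0 \<and>
              (\<lambda>n. \<integral>\<^sup>+x. ennreal ((W n x - t x)\<^sup>2) \<partial>boundary_measure \<Omega>) \<longlonglongrightarrow> 0)"

definition H1D :: "(real^2) set \<Rightarrow> (real^2) set \<Rightarrow> (real^2 \<Rightarrow> real) set"
  where "H1D \<Omega> \<Gamma>\<^sub>D = {w \<in> H1 \<Omega>. \<exists>t. has_trace \<Omega> w t \<and>
           (AE x in boundary_measure \<Omega>. x \<in> \<Gamma>\<^sub>D \<longrightarrow> t x = 0)}"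


section \<open>The boundary value problem and its constants\<close>

definition weak_solution ::
    "(real^2) set \<Rightarrow> (real^2) set \<Rightarrow> (real \<Rightarrow> real) \<Rightarrow> (real^2 \<Rightarrow> real) \<Rightarrow> (real^2 \<Rightarrow> real) \<Rightarrow>
      (real^2 \<Rightarrow> real) \<Rightarrow> bool"
  where "weak_solution \<Omega> \<Gamma>\<^sub>D \<kappa> z g u \<longleftrightarrow> u \<in> H1D \<Omega> \<Gamma>\<^sub>D \<and>
           (\<forall>\<phi> \<in> H1D \<Omega> \<Gamma>\<^sub>D.
              L2_inner \<Omega> (\<lambda>x. \<kappa> (z x) *\<^sub>R wgrad \<Omega> u x) (wgrad \<Omega> \<phi>) = L2_inner \<Omega> g \<phi>)"

definition poincare_constant :: "(real^2) set \<Rightarrow> (real^2) set \<Rightarrow> real \<Rightarrow> bool"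
  where "poincare_constant \<Omega> \<Gamma>\<^sub>D b\<^sub>0 \<longleftrightarrow> b\<^sub>0 > 0 \<and>
           (\<forall>u \<in> H1D \<Omega> \<Gamma>\<^sub>D. b\<^sub>0 * H1_norm \<Omega> u \<le> Lp_norm \<Omega> 2 (wgrad \<Omega> u) \<and>
              Lp_norm \<Omega> 2 (wgrad \<Omega> u) \<le> H1_norm \<Omega> u)"

text \<open>The constant is indexed by the exponents: in two dimensions no single constant serves all
  \<open>a < \<infinity>\<close>, since letting \<open>a \<rightarrow> \<infinity>\<close> would embed \<open>H\<^sup>1(\<Omega>)\<close> into \<open>L\<^sup>\<infinity>(\<Omega>)\<close>. Membership in
  \<open>L\<^sup>a(\<Omega>)\<close> is stated separately because \<open>Lp_norm\<close> is \<open>0\<close> where the integral diverges; likewise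
  for the Meyers estimate below.\<close>

definition gagliardo_nirenberg_constants :: "(real^2) set \<Rightarrow> (real \<Rightarrow> real \<Rightarrow> real) \<Rightarrow> bool"
  where "gagliardo_nirenberg_constants \<Omega> C \<longleftrightarrow>
           (\<forall>a c. \<forall>u \<in> H1 \<Omega>. 1 \<le> c \<and> c \<le> a \<longrightarrow> u \<in> Lp_space \<Omega> a \<and>
              Lp_norm \<Omega> a u \<le> C a c * Lp_norm \<Omega> c u powr (c / a) * H1_norm \<Omega> u powr (1 - c / a))"

definition meyers_constants ::
    "(real^2) set \<Rightarrow> (real^2) set \<Rightarrow> (real \<Rightarrow> real) \<Rightarrow> ereal \<Rightarrow> (real \<Rightarrow> real) \<Rightarrow> bool"
  where "meyers_constants \<Omega> \<Gamma>\<^sub>D \<kappa> r\<^sub>0 C \<longleftrightarrow> 2 < r\<^sub>0 \<and>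
           (\<forall>r. 2 \<le> r \<and> ereal r < r\<^sub>0 \<longrightarrow>
              (\<forall>z \<in> borel_measurable (lebesgue_on \<Omega>). \<forall>g \<in> Lp_space \<Omega> 2. \<forall>u.
                 weak_solution \<Omega> \<Gamma>\<^sub>D \<kappa> z g u \<longrightarrow>
                 u \<in> W1_space \<Omega> r \<and> W1_norm \<Omega> r u \<le> C r * Lp_norm \<Omega> 2 g))"

end

theory Submission
  imports Defs
begin

text \<open>Write \<open>e = u\<^sub>1 - u\<^sub>2\<close> and \<open>w = (\<kappa>(z\<^sub>1) - \<kappa>(z\<^sub>2))\<nabla>u\<^sub>2\<close>. Subtracting the two equations and testing
  with \<open>e\<close> gives \<open>\<langle>\<kappa>(z\<^sub>1)\<nabla>e, \<nabla>e\<rangle> = -\<langle>w, \<nabla>e\<rangle>\<close>, hence \<open>\<parallel>\<nabla>e\<parallel> \<le> \<parallel>w\<parallel> / \<kappa>\<^sub>l\<close>; the flux difference is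
  \<open>\<kappa>(z\<^sub>1)\<nabla>e + w\<close>. By the Lipschitz bound and Hoelder's inequality,
  \<open>\<parallel>w\<parallel> \<le> L \<parallel>z\<^sub>1 - z\<^sub>2\<parallel>\<close> (in \<open>L\<^sup>s\<close>) times \<open>\<parallel>\<nabla>u\<^sub>2\<parallel>\<close> (in \<open>L\<^sup>r\<close>); the first factor is bounded by the
  Gagliardo-Nirenberg and Poincare inequalities, the second by the Meyers estimate.

  Since \<open>wgrad\<close> is an arbitrary choice of weak gradient, its linearity (almost everywhere) rests on
  the uniqueness of weak gradients, i.e. on the fundamental lemma of the calculus of variations. It is
  enough to test against smooth functions that converge boundedly to indicators of boxes.\<close>

section \<open>Smooth bump functions\<close>

lemma partial_eqI:
  assumes "(f has_derivative D) (at x)"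
  shows "partial i f x = D (axis i 1)"
  using frechet_derivative_at[OF assms] by (simp add: partial_def)

lemma C_k_const: "C_k k (\<lambda>x. c)"
proof (induction k arbitrary: c)
  case (Suc k)
  have "partial i (\<lambda>x. c) = (\<lambda>x::real^'a. 0)" for i
    by (auto intro!: ext partial_eqI[THEN trans] derivative_eq_intros)
  then show ?case using Suc[of 0] by simp
qed simp

text \<open>Continuity is demanded explicitly only at order 0, so lowering the order needs an
  induction, whose base case is that differentiable functions are continuous.\<close>

lemma C_k_SucD: "C_k (Suc k) f \<Longrightarrow> C_k k f"
proof (induction k arbitrary: f)
  case 0
  then have "f differentiable_on UNIV" by (simp add: differentiable_on_def)
  then show ?case by (simp add: differentiable_imp_continuous_on)
qed simp

lemma has_derivative_partial:
  assumes "f differentiable (at x)"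
  obtains D where "(f has_derivative D) (at x)" "\<And>i. partial i f x = D (axis i 1)"
proof -
  obtain D where D: "(f has_derivative D) (at x)" using assms by (auto simp: differentiable_def)
  show thesis by (rule that[OF D partial_eqI[OF D]])
qed

lemma partial_add:
  assumes "f differentiable (at x)" "g differentiable (at x)"
  shows "partial i (\<lambda>x. f x + g x) x = partial i f x + partial i g x"
proof -
  obtain D where D: "(f has_derivative D) (at x)" "\<And>i. partial i f x = D (axis i 1)"
    using has_derivative_partial[OF assms(1)] by blast
  obtain E where E: "(g has_derivative E) (at x)" "\<And>i. partial i g x = E (axis i 1)"
    using has_derivative_partial[OF assms(2)] by blast
  show ?thesis
    using partial_eqI[OF has_derivative_add[OF D(1) E(1)]] by (simp add: D(2) E(2))
qed

lemma partial_mult: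
  assumes "f differentiable (at x)" "g differentiable (at x)"
  shows "partial i (\<lambda>x. f x * g x) x = partial i f x * g x + f x * partial i g x"
proof -
  obtain D where D: "(f has_derivative D) (at x)" "\<And>i. partial i f x = D (axis i 1)"
    using has_derivative_partial[OF assms(1)] by blast
  obtain E where E: "(g has_derivative E) (at x)" "\<And>i. partial i g x = E (axis i 1)"
    using has_derivative_partial[OF assms(2)] by blast
  show ?thesis
    using partial_eqI[OF has_derivative_mult[OF D(1) E(1)]] by (simp add: D(2) E(2))
qed

lemma C_k_add: "C_k k f \<Longrightarrow> C_k k g \<Longrightarrow> C_k k (\<lambda>x. f x + g x)"
proof (induction k arbitrary: f g)
  case (Suc k)
  then have "partial i (\<lambda>x. f x + g x) = (\<lambda>x. partial i f x + partial i g x)" for i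
    by (auto simp: partial_add)
  with Suc show ?case by auto
qed (auto intro: continuous_intros)

lemma C_k_mult: "C_k k f \<Longrightarrow> C_k k g \<Longrightarrow> C_k k (\<lambda>x. f x * g x)"
proof (induction k arbitrary: f g)
  case (Suc k)
  then have "partial i (\<lambda>x. f x * g x) = (\<lambda>x. partial i f x * g x + f x * partial i g x)" for i
    by (auto simp: partial_mult)
  moreover have "C_k k (\<lambda>x. partial i f x * g x + f x * partial i g x)" for i
    using Suc C_k_SucD by (intro C_k_add Suc.IH) auto
  ultimately show ?case using Suc.prems by auto
qed (auto intro: continuous_intros)

lemma C_k_prod: "finite I \<Longrightarrow> (\<And>i. i \<in> I \<Longrightarrow> C_k k (f i)) \<Longrightarrow> C_k k (\<lambda>x. \<Prod>i\<in>I. f i x)"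
  by (induction I rule: finite_induct) (auto intro: C_k_const C_k_mult)

text \<open>The derivative of a member of this family is a linear combination of members, so a single
  induction shows that all of them are smooth.\<close>

definition flat :: "nat \<Rightarrow> real \<Rightarrow> real"
  where "flat m t = (if t > 0 then exp (- (1 / t)) / t ^ m else 0)"

text \<open>On the right, substituting the inverse of \<open>t\<close> reduces this to the decay of
  a power divided by the exponential; on the left the function is identically 0.\<close>

lemma flat_tendsto_0: "(flat m \<longlongrightarrow> 0) (at 0)"
proof -
  have "((\<lambda>t::real. inverse t ^ m / exp (inverse t)) \<longlongrightarrow> 0) (at_right 0)"
    using filterlim_compose[OF tendsto_power_div_exp_0 filterlim_inverse_at_top_right] .
  moreover have "\<forall>\<^sub>F t in at_right 0. inverse t ^ m / exp (inverse t) = flat m t"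
    unfolding eventually_at_right_field
    by (intro exI[of _ 1]) (auto simp: flat_def exp_minus field_simps)
  ultimately have "(flat m \<longlongrightarrow> 0) (at_right 0)"
    by (rule Lim_transform_eventually)
  moreover have "(flat m \<longlongrightarrow> 0) (at_left 0)"
    by (rule tendsto_eventually)
      (auto simp: eventually_at_left_field flat_def intro: exI[of _ "-1"])
  ultimately show ?thesis by (rule filterlim_split_at[rotated])
qed

lemma flat_has_derivative:
  "(flat m has_field_derivative (flat (m + 2) t - real m * flat (m + 1) t)) (at t)"
proof -
  consider "t > 0" | "t < 0" | "t = 0" by linarith
  then show ?thesis
  proof cases
    case 1
    \<comment> \<open>Splitting on \<open>m\<close> deals with the truncated exponent
      \<open>m - 1\<close> that the power rule produces.\<close>
    have "((\<lambda>t. exp (- (1 / t)) / t ^ m) has_field_derivative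
        (flat (m + 2) t - real m * flat (m + 1) t)) (at t)"
      using 1 by (cases m) (auto intro!: derivative_eq_intros
          simp: flat_def field_simps power2_eq_square, metis power_eq_if One_nat_def)
    then show ?thesis
      by (rule has_field_derivative_transform_within_open[of _ _ _ "{0<..}"])
        (use 1 in \<open>auto simp: flat_def\<close>)
  next
    case 2
    then have "flat (m + 2) t - real m * flat (m + 1) t = 0" by (simp add: flat_def)
    moreover have "(flat m has_field_derivative 0) (at t)"
      by (rule has_field_derivative_transform_within_open[of "\<lambda>_. 0" _ _ "{..<0}"])
        (use 2 in \<open>auto simp: flat_def\<close>)
    ultimately show ?thesis by simp
  next
    case 3
    \<comment> \<open>The difference quotient of \<open>flat m\<close> at 0 is
      \<open>flat (Suc m)\<close>, so the limit already computed for every index is the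
      derivative.\<close>
    have "(flat m has_field_derivative 0) (at 0)"
      unfolding has_field_derivative_iff
      by (rule Lim_transform_eventually[OF flat_tendsto_0[of "Suc m"]])
        (auto simp: flat_def eventually_at_filter)
    then show ?thesis using 3 by (simp add: flat_def)
  qed
qed

lemma C_k_flat: "C_k k (\<lambda>x. flat m (c * x $ j + d))"
proof (induction k arbitrary: m)
  case 0
  have "continuous_on UNIV (flat m)"
    by (meson DERIV_isCont continuous_at_imp_continuous_on flat_has_derivative)
  then show ?case
    by (auto intro!: continuous_intros continuous_on_compose2[of UNIV "flat m"])
next
  case (Suc k)
  let ?h = "\<lambda>x. flat (m + 2) (c * x $ j + d) + (- real m) * flat (m + 1) (c * x $ j + d)"
  have D: "((\<lambda>x. flat m (c * x $ j + d)) has_derivative (\<lambda>v. ?h x * (c * v $ j))) (at x)" for x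
  proof -
    have "((\<lambda>x. c * x $ j + d) has_derivative (\<lambda>v. c * v $ j)) (at x)"
      by (auto intro!: derivative_eq_intros bounded_linear.has_derivative[OF bounded_linear_vec_nth])
    from has_derivative_compose[OF this] flat_has_derivative[of m "c * x $ j + d"]
    show ?thesis by (simp add: has_field_derivative_def)
  qed
  have "partial i (\<lambda>x. flat m (c * x $ j + d)) = (\<lambda>x. ?h x * (c * axis i 1 $ j))" for i
    using partial_eqI[OF D] by auto
  moreover have "C_k k (\<lambda>x. ?h x * (c * axis i 1 $ j))" for i
    by (intro C_k_mult C_k_add C_k_const Suc)
  ultimately show ?case using D by (auto simp: differentiable_def)
qed

text \<open>Each coordinate contributes one factor that vanishes unless \<open>x $ i\<close> exceeds
  \<open>a $ i\<close> and one that vanishes unless it is below \<open>b $ i\<close>. The scaling by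
  \<open>Suc n\<close> drives the factors to 1 inside the box. The arguments are written as
  \<open>c * x $ i + d\<close> to fit \<open>C_k_flat\<close>.\<close>

definition box_bump :: "nat \<Rightarrow> real^'n::finite \<Rightarrow> real^'n \<Rightarrow> real^'n \<Rightarrow> real"
  where "box_bump n a b x =
    (\<Prod>i\<in>UNIV. flat 0 (Suc n * x $ i + - (Suc n * a $ i)) * flat 0 (- real (Suc n) * x $ i + Suc n * b $ i))"

lemma flat_0_pos_iff: "flat 0 t \<noteq> 0 \<longleftrightarrow> t > 0" and flat_0_bounds: "0 \<le> flat 0 t" "flat 0 t \<le> 1"
  by (auto simp: flat_def)

lemma box_bump_nonzero_iff: "box_bump n a b x \<noteq> 0 \<longleftrightarrow> x \<in> box a b"
proof -
  have "0 < Suc n * x $ i + - (Suc n * a $ i) \<longleftrightarrow> a $ i < x $ i"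
    "0 < - real (Suc n) * x $ i + Suc n * b $ i \<longleftrightarrow> x $ i < b $ i" for i
    by (auto simp del: of_nat_Suc)
  then show ?thesis
    unfolding box_bump_def by (auto simp: flat_0_pos_iff mem_box_cart simp del: of_nat_Suc)
qed

lemma box_bump_bounds: "0 \<le> box_bump n a b x" "box_bump n a b x \<le> 1"
  unfolding box_bump_def
  by (auto intro!: prod_nonneg prod_le_1 mult_nonneg_nonneg mult_le_one flat_0_bounds simp del: of_nat_Suc)

text \<open>Inside the box every factor has the form \<open>exp (- 1 / (Suc n * t))\<close> with
  \<open>t > 0\<close> and tends to 1; outside, every bump is 0.\<close>

lemma box_bump_tendsto: "(\<lambda>n. box_bump n a b x) \<longlonglongrightarrow> indicator (box a b) x"
proof (cases "x \<in> box a b")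
  case True
  have lim: "(\<lambda>n. flat 0 (Suc n * t)) \<longlonglongrightarrow> 1" if "t > 0" for t :: real
  proof -
    have "(\<lambda>n. exp (- ((1 / t) * inverse (real (Suc n))))) \<longlonglongrightarrow> exp (- ((1 / t) * 0))"
      by (intro tendsto_intros LIMSEQ_inverse_real_of_nat)
    moreover have "exp (- ((1 / t) * inverse (real (Suc n)))) = flat 0 (Suc n * t)" for n
      using that by (simp add: flat_def field_simps zero_less_mult_iff del: of_nat_Suc)
    ultimately show ?thesis by simp
  qed
  have "(\<lambda>n. \<Prod>i\<in>UNIV. flat 0 (Suc n * (x $ i - a $ i)) * flat 0 (Suc n * (b $ i - x $ i)))
      \<longlonglongrightarrow> (\<Prod>i\<in>(UNIV::'a set). 1 * 1)"
    using True by (intro tendsto_prod tendsto_mult lim) (auto simp: mem_box_cart)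
  then show ?thesis using True unfolding box_bump_def by (simp add: algebra_simps)
next
  case False
  then have "box_bump n a b x = 0" for n using box_bump_nonzero_iff by blast
  then show ?thesis using False by simp
qed

text \<open>The bump is nonzero exactly on the open box, so its support lies in the closed box; this
  is why the closed box has to lie in \<open>\<Omega>\<close>.\<close>

lemma test_function_box_bump:
  assumes "cbox a b \<subseteq> \<Omega>"
  shows "test_function \<Omega> (box_bump n a b)"
proof -
  have supp: "{x. box_bump n a b x \<noteq> 0} = box a b"
    using box_bump_nonzero_iff by auto
  have "closure (box a b) \<subseteq> cbox a b"
    by (rule closure_minimal[OF box_subset_cbox closed_cbox])
  moreover have "C_k k (box_bump n a b)" for k
    unfolding box_bump_def by (intro C_k_prod C_k_mult C_k_flat) auto
  ultimately show ?thesis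
    using assms by (auto simp: test_function_def supp)
qed

section \<open>Uniqueness of weak gradients\<close>

text \<open>A Dynkin argument carries the vanishing of the integrals from boxes to Borel sets, and
  completion carries it on to Lebesgue sets. Integrating over the sets where the function is
  positive or negative then leaves only null sets.\<close>

lemma AE_zero_of_box_integrals_zero:
  fixes f :: "'a::euclidean_space \<Rightarrow> real"
  assumes f: "set_integrable lebesgue (box c d) f"
    and zero: "\<And>a b. box a b \<subseteq> box c d \<Longrightarrow> (LINT x:box a b|lebesgue. f x) = 0"
  shows "AE x in lebesgue. x \<in> box c d \<longrightarrow> f x = 0"
proof -
  \<comment> \<open>After extension by 0 every box may be used: its intersection with
    \<open>box c d\<close> is again a box, and one covered by the hypothesis.\<close>
  define F where "F x = indicator (box c d) x *\<^sub>R f x" for x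
  have F: "integrable lebesgue F"
    using f unfolding set_integrable_def F_def .
  have F_set: "set_integrable lebesgue A F" if "A \<in> sets lebesgue" for A
    using that integrable_mult_indicator[OF _ F] by (simp add: set_integrable_def)
  have box0: "(LINT x:box a b|lebesgue. F x) = 0" for a b
  proof -
    have "(LINT x:box a b|lebesgue. F x) = (LINT x:box a b \<inter> box c d|lebesgue. f x)"
      unfolding set_lebesgue_integral_def F_def
      by (rule Bochner_Integration.integral_cong) (auto simp: indicator_def)
    also have "\<dots> = 0"
      using zero box_Int_box[of a b c d] Int_lower2[of "box a b" "box c d"] by simp
    finally show ?thesis .
  qed
  \<comment> \<open>The integral over the whole space is what the complement step of the Dynkin
    induction subtracts from.\<close>
  have total: "(LINT x|lebesgue. F x) = 0"
  proof -
    have "(LINT x|lebesgue. F x) = (LINT x:box c d|lebesgue. F x)"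
      unfolding set_lebesgue_integral_def F_def
      by (rule Bochner_Integration.integral_cong) (auto simp: indicator_def)
    then show ?thesis using box0 by simp
  qed
  have borel0: "(LINT x:A|lebesgue. F x) = 0" if "A \<in> sets borel" for A
  proof -
    let ?G = "range (\<lambda>(a, b). box a b :: 'a set)"
    have gen: "sigma_sets UNIV ?G = sets borel"
      by (subst borel_eq_box) simp
    have A: "A \<in> sigma_sets UNIV ?G" using that gen by simp
    have G: "Int_stable ?G" "?G \<subseteq> Pow UNIV" by (auto simp: Int_stable_def box_Int_box)
    show ?thesis
    proof (induction rule: sigma_sets_induct_disjoint[OF G A])
      case (1 A)
      then show ?case using box0 by auto
    next
      case (3 A)
      then have A: "A \<in> sets lebesgue" using gen by simp
      have "(LINT x:UNIV - A|lebesgue. F x) = (LINT x|lebesgue. F x - indicator A x *\<^sub>R F x)"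
        unfolding set_lebesgue_integral_def
        by (rule Bochner_Integration.integral_cong) (auto simp: indicator_def)
      also have "\<dots> = (LINT x|lebesgue. F x) - (LINT x:A|lebesgue. F x)"
        unfolding set_lebesgue_integral_def
        by (rule Bochner_Integration.integral_diff[OF F integrable_mult_indicator[OF A F]])
      finally show ?case using total 3 by simp
    next
      case (4 A)
      then have A: "A i \<in> sets lebesgue" for i using gen by auto
      have "(LINT x:(\<Union>i. A i)|lebesgue. F x) = (\<Sum>i. (LINT x:A i|lebesgue. F x))"
        using A 4 by (intro lebesgue_integral_countable_add F_set)
          (auto simp: disjoint_family_on_def)
      then show ?case using 4 by simp
    qed (auto simp: set_lebesgue_integral_def)
  qed
  \<comment> \<open>A Lebesgue set differs from a Borel set only within a null set, which the
    integral does not see.\<close>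
  have leb0: "(LINT x:A|lebesgue. F x) = 0" if A: "A \<in> sets lebesgue" for A
  proof -
    obtain S N N' where S: "A = S \<union> N" "N \<subseteq> N'" "N' \<in> null_sets lborel" "S \<in> sets lborel"
      using sets_completionE[OF A] .
    have "AE x in lebesgue. x \<notin> N'"
      using AE_not_in[OF null_sets_completionI[OF S(3)]] .
    then have "AE x in lebesgue. indicator A x *\<^sub>R F x = indicator S x *\<^sub>R F x"
      by eventually_elim (use S in \<open>auto simp: indicator_def\<close>)
    moreover have "S \<in> sets lebesgue" using S by simp
    ultimately have "(LINT x:A|lebesgue. F x) = (LINT x:S|lebesgue. F x)"
      unfolding set_lebesgue_integral_def using A F
      by (intro integral_cong_AE borel_measurable_scaleR borel_measurable_indicator) auto
    then show ?thesis using borel0 S by simp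
  qed
  define P where "P = {x \<in> space lebesgue. F x > 0}"
  define N where "N = {x \<in> space lebesgue. F x < 0}"
  have PN: "P \<in> sets lebesgue" "N \<in> sets lebesgue"
    unfolding P_def N_def
    by (intro borel_measurable_less borel_measurable_const borel_measurable_integrable[OF F])+
  have "AE x in lebesgue. indicator P x *\<^sub>R F x = 0"
    using leb0[OF PN(1)] unfolding set_lebesgue_integral_def
    by (rule integral_nonneg_eq_0_iff_AE[OF integrable_mult_indicator[OF PN(1) F], THEN iffD1, rotated])
      (auto simp: P_def indicator_def)
  moreover have "AE x in lebesgue. - (indicator N x *\<^sub>R F x) = 0"
  proof (rule integral_nonneg_eq_0_iff_AE[OF integrable_minus[OF integrable_mult_indicator[OF PN(2) F]], THEN iffD1])
    show "(LINT x|lebesgue. - (indicator N x *\<^sub>R F x)) = 0"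
      using leb0[OF PN(2)] unfolding set_lebesgue_integral_def integral_minus by simp
  qed (auto simp: N_def indicator_def)
  ultimately show ?thesis
  proof eventually_elim
    case (elim x)
    then show ?case by (cases "F x" "0::real" rule: linorder_cases) (auto simp: P_def N_def F_def)
  qed
qed

text \<open>Local integrability gives measurability on each compact subset, and an open set is a
  countable union of closed boxes, on which the function can be treated piecewise.\<close>

lemma locally_integrable_measurable:
  assumes "open \<Omega>" "locally_integrable \<Omega> f"
  shows "f \<in> borel_measurable (lebesgue_on \<Omega>)"
proof -
  obtain \<D> where \<D>: "countable \<D>" "\<D> \<subseteq> Pow \<Omega>" "\<And>X. X \<in> \<D> \<Longrightarrow> \<exists>a b. X = cbox a b" "\<Union>\<D> = \<Omega>"
    using open_countable_Union_open_cbox[OF assms(1)] by metis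
  show ?thesis
  proof (rule measurable_piecewise_restrict[OF \<D>(1)])
    fix X assume X: "X \<in> \<D>"
    then obtain a b where ab: "X = cbox a b" "X \<subseteq> \<Omega>" using \<D>(2,3) by blast
    then have "set_integrable lebesgue X f"
      using assms(2) by (auto simp: locally_integrable_def)
    then have "(\<lambda>x. indicator X x *\<^sub>R f x) \<in> borel_measurable lebesgue"
      by (auto simp: set_integrable_def)
    then have "f \<in> borel_measurable (lebesgue_on X)"
      using ab by (subst borel_measurable_restrict_space_iff) auto
    moreover have "restrict_space (lebesgue_on \<Omega>) X = lebesgue_on X"
      using ab assms(1) by (subst restrict_restrict_space) (auto simp: Int_absorb1)
    ultimately show "f \<in> borel_measurable (restrict_space (lebesgue_on \<Omega>) X)" by simp
    show "X \<inter> space (lebesgue_on \<Omega>) \<in> sets (lebesgue_on \<Omega>)"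
      using ab assms(1) by (subst sets_restrict_space_iff) auto
  qed (use \<D>(4) in auto)
qed

text \<open>Testing with the bumps and passing to the limit shows that the integral over every box
  with closure in \<open>\<Omega>\<close> vanishes. Hence \<open>f\<close> is 0 almost everywhere on
  each closed box in \<open>\<Omega>\<close>, and countably many of these cover
  \<open>\<Omega>\<close>.\<close>

lemma fundamental_lemma_calculus_of_variations:
  fixes f :: "real^'n::finite \<Rightarrow> real"
  assumes \<Omega>: "open \<Omega>" and f: "locally_integrable \<Omega> f"
    and orth: "\<And>\<phi>. test_function \<Omega> \<phi> \<Longrightarrow> (\<integral>x. f x * \<phi> x \<partial>lebesgue_on \<Omega>) = 0"
  shows "AE x in lebesgue_on \<Omega>. f x = 0"
proof -
  have \<Omega>_sets: "\<Omega> \<inter> space lebesgue \<in> sets lebesgue" using \<Omega> by simp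
  have int0: "(LINT x:box a b|lebesgue. f x) = 0" if ab: "cbox a b \<subseteq> \<Omega>" for a b
  proof -
    have fi: "integrable lebesgue (\<lambda>x. indicator (cbox a b) x *\<^sub>R f x)"
      using f ab by (auto simp: locally_integrable_def set_integrable_def)
    have bump_meas: "box_bump n a b \<in> borel_measurable lebesgue" for n
    proof -
      have "continuous_on UNIV (box_bump n a b)"
        using test_function_box_bump[OF ab, of n] C_k.simps(1) unfolding test_function_def by blast
      then show ?thesis
        by (intro measurable_completion) (simp add: borel_measurable_continuous_onI)
    qed
    \<comment> \<open>Dominated convergence: the bumps lie between 0 and 1, and \<open>f\<close> is
      integrable on the compact closed box.\<close>
    have lim: "(\<lambda>n. \<integral>x. (indicator (cbox a b) x *\<^sub>R f x) * box_bump n a b x \<partial>lebesgue)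
      \<longlonglongrightarrow> (\<integral>x. (indicator (cbox a b) x *\<^sub>R f x) * indicator (box a b) x \<partial>lebesgue)"
    proof (rule integral_dominated_convergence[where w = "\<lambda>x. \<bar>indicator (cbox a b) x *\<^sub>R f x\<bar>"])
      show "AE x in lebesgue. (\<lambda>n. (indicator (cbox a b) x *\<^sub>R f x) * box_bump n a b x)
          \<longlonglongrightarrow> (indicator (cbox a b) x *\<^sub>R f x) * indicator (box a b) x"
        by (intro always_eventually allI tendsto_mult_left box_bump_tendsto)
      show "AE x in lebesgue. norm ((indicator (cbox a b) x *\<^sub>R f x) * box_bump n a b x)
          \<le> \<bar>indicator (cbox a b) x *\<^sub>R f x\<bar>" for n
      proof (intro always_eventually allI)
        fix x
        show "norm ((indicator (cbox a b) x *\<^sub>R f x) * box_bump n a b x)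
          \<le> \<bar>indicator (cbox a b) x *\<^sub>R f x\<bar>"
          using mult_left_mono[OF box_bump_bounds(2)[of n a b x], of "\<bar>indicator (cbox a b) x *\<^sub>R f x\<bar>"]
            box_bump_bounds(1)[of n a b x]
          by (simp add: abs_mult)
      qed
      show "(\<lambda>x. (indicator (cbox a b) x *\<^sub>R f x) * indicator (box a b) x) \<in> borel_measurable lebesgue"
        by (intro borel_measurable_times borel_measurable_integrable[OF fi] borel_measurable_indicator) simp
      show "(\<lambda>x. (indicator (cbox a b) x *\<^sub>R f x) * box_bump n a b x) \<in> borel_measurable lebesgue" for n
        by (intro borel_measurable_times borel_measurable_integrable[OF fi] bump_meas)
    qed (use fi in auto)
    \<comment> \<open>The bump vanishes off the open box, so this is the integral over
      \<open>\<Omega>\<close> of \<open>f\<close> against a test function.\<close>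
    have zero: "(\<integral>x. (indicator (cbox a b) x *\<^sub>R f x) * box_bump n a b x \<partial>lebesgue) = 0" for n
    proof -
      have "(\<integral>x. (indicator (cbox a b) x *\<^sub>R f x) * box_bump n a b x \<partial>lebesgue)
        = (\<integral>x. indicator \<Omega> x *\<^sub>R (f x * box_bump n a b x) \<partial>lebesgue)"
      proof (rule Bochner_Integration.integral_cong)
        fix x
        show "(indicator (cbox a b) x *\<^sub>R f x) * box_bump n a b x = indicator \<Omega> x *\<^sub>R (f x * box_bump n a b x)"
          using ab box_bump_nonzero_iff[of n a b x] box_subset_cbox[of a b]
          by (cases "x \<in> box a b") (auto simp: indicator_def)
      qed simp
      also have "\<dots> = 0"
        using orth[OF test_function_box_bump[OF ab]] by (simp add: integral_restrict_space[OF \<Omega>_sets])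
      finally show ?thesis .
    qed
    have "(\<integral>x. (indicator (cbox a b) x *\<^sub>R f x) * indicator (box a b) x \<partial>lebesgue) = 0"
      by (rule LIMSEQ_unique[OF lim[unfolded zero] tendsto_const])
    moreover have "(indicator (cbox a b) x *\<^sub>R f x) * indicator (box a b) x = indicator (box a b) x *\<^sub>R f x" for x
      using box_subset_cbox[of a b] by (auto simp: indicator_def)
    ultimately show ?thesis unfolding set_lebesgue_integral_def by (simp only:)
  qed
  have cbox0: "AE x in lebesgue. x \<in> cbox c d \<longrightarrow> f x = 0" if cd: "cbox c d \<subseteq> \<Omega>" for c d
  proof -
    have "set_integrable lebesgue (cbox c d) f"
      using f cd by (auto simp: locally_integrable_def)
    then have "set_integrable lebesgue (box c d) f"
      by (rule set_integrable_subset) (auto simp: box_subset_cbox)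
    moreover have "(LINT x:box a b|lebesgue. f x) = 0" if "box a b \<subseteq> box c d" for a b
    \<comment> \<open>For a nonempty open box the closure is the closed box, so the inclusion passes
      to closed boxes and \<open>int0\<close> applies. An empty open box is separate because
      \<open>cbox a b\<close> need not be empty then.\<close>
    proof (cases "box a b = {}")
      case False
      then have "cbox a b = closure (box a b)" by simp
      also have "\<dots> \<subseteq> cbox c d"
        using that box_subset_cbox[of c d] by (intro closure_minimal) auto
      finally show ?thesis using int0 cd by blast
    qed (simp add: set_lebesgue_integral_def)
    ultimately have "AE x in lebesgue. x \<in> box c d \<longrightarrow> f x = 0"
      by (rule AE_zero_of_box_integrals_zero)
    \<comment> \<open>The faces of a box form a null set, so the open box may be replaced by the
      closed one.\<close>
    moreover have "AE x in lebesgue. x \<notin> cbox c d - box c d"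
      by (intro AE_not_in) (metis negligible_frontier_interval negligible_iff_null_sets)
    ultimately show ?thesis by eventually_elim auto
  qed
  obtain \<D> where \<D>: "countable \<D>" "\<D> \<subseteq> Pow \<Omega>" "\<And>X. X \<in> \<D> \<Longrightarrow> \<exists>a b. X = cbox a b" "\<Union>\<D> = \<Omega>"
    using open_countable_Union_open_cbox[OF \<Omega>] by metis
  have "AE x in lebesgue. \<forall>X\<in>\<D>. x \<in> X \<longrightarrow> f x = 0"
  proof (rule AE_ball_countable'[OF _ \<D>(1)])
    fix X assume "X \<in> \<D>"
    then obtain a b where "X = cbox a b" "cbox a b \<subseteq> \<Omega>" using \<D>(2,3) by blast
    then show "AE x in lebesgue. x \<in> X \<longrightarrow> f x = 0" using cbox0 by simp
  qed
  then have "AE x in lebesgue. x \<in> \<Omega> \<longrightarrow> f x = 0"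
    by eventually_elim (use \<D>(4) in blast)
  then show ?thesis by (simp add: AE_restrict_space_iff[OF \<Omega>_sets])
qed

section \<open>Pairing locally integrable functions with test functions\<close>

lemma locally_integrable_component:
  fixes G :: "'a::euclidean_space \<Rightarrow> real^'n::finite"
  shows "locally_integrable \<Omega> G \<Longrightarrow> locally_integrable \<Omega> (\<lambda>x. G x $ i)"
  unfolding locally_integrable_def set_integrable_def
  using integrable_bounded_linear[OF bounded_linear_vec_nth[of i]] by fastforce

lemma locally_integrable_diff:
  "locally_integrable \<Omega> f \<Longrightarrow> locally_integrable \<Omega> g \<Longrightarrow> locally_integrable \<Omega> (\<lambda>x. f x - g x)"
  by (auto simp: locally_integrable_def)

text \<open>The continuous factor is bounded on \<open>K\<close> and vanishes elsewhere, so the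
  product is dominated by a multiple of \<open>f\<close> restricted to \<open>K\<close>, which is
  integrable.\<close>

lemma integrable_mult_compact_support:
  fixes f \<psi> :: "'a::euclidean_space \<Rightarrow> real"
  assumes \<Omega>: "open \<Omega>" and f: "locally_integrable \<Omega> f" and \<psi>: "continuous_on UNIV \<psi>"
    and K: "compact K" "K \<subseteq> \<Omega>" and supp: "\<And>x. x \<notin> K \<Longrightarrow> \<psi> x = 0"
  shows "integrable (lebesgue_on \<Omega>) (\<lambda>x. f x * \<psi> x)"
proof -
  have "compact (\<psi> ` K)"
    using K \<psi> by (intro compact_continuous_image) (auto intro: continuous_on_subset)
  then obtain B where B: "\<And>x. x \<in> K \<Longrightarrow> \<bar>\<psi> x\<bar> \<le> B"
    using compact_imp_bounded[of "\<psi> ` K"] by (auto simp: bounded_iff)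
  have \<Omega>_sets: "\<Omega> \<inter> space lebesgue \<in> sets lebesgue" using \<Omega> by simp
  have fK: "integrable lebesgue (\<lambda>x. indicator K x *\<^sub>R f x)"
    using f K by (auto simp: locally_integrable_def set_integrable_def)
  have "\<psi> \<in> borel_measurable lebesgue"
    by (intro measurable_completion) (simp add: borel_measurable_continuous_onI \<psi>)
  then have "integrable lebesgue (\<lambda>x. (indicator K x *\<^sub>R f x) * \<psi> x)"
    using fK
  proof (intro Bochner_Integration.integrable_bound[OF integrable_mult_right[OF fK, of B]])
    show "AE x in lebesgue. norm ((indicator K x *\<^sub>R f x) * \<psi> x) \<le> norm (B * (indicator K x *\<^sub>R f x))"
    proof (intro always_eventually allI)
      fix x
      show "norm ((indicator K x *\<^sub>R f x) * \<psi> x) \<le> norm (B * (indicator K x *\<^sub>R f x))"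
        using B[of x] mult_left_mono[of "\<bar>\<psi> x\<bar>" "\<bar>B\<bar>" "\<bar>f x\<bar>"]
        by (cases "x \<in> K") (auto simp: abs_mult mult.commute)
    qed
  qed auto
  moreover have "(indicator K x *\<^sub>R f x) * \<psi> x = indicator \<Omega> x *\<^sub>R (f x * \<psi> x)" for x
    using supp K by (auto simp: indicator_def)
  ultimately show ?thesis unfolding integrable_restrict_space[OF \<Omega>_sets] by (simp only:)
qed

lemma test_function_C_k: "test_function \<Omega> \<phi> \<Longrightarrow> C_k k \<phi>"
  by (simp add: test_function_def)

lemma integrable_mult_test_function:
  assumes "open \<Omega>" "locally_integrable \<Omega> f" "test_function \<Omega> \<phi>"
  shows "integrable (lebesgue_on \<Omega>) (\<lambda>x. f x * \<phi> x)"
  using assms test_function_C_k[OF assms(3), of 0, unfolded C_k.simps] closure_subset[of "{x. \<phi> x \<noteq> 0}"]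
  by (intro integrable_mult_compact_support[where K = "closure {x. \<phi> x \<noteq> 0}"])
    (auto simp: test_function_def simp del: compact_closure)

lemma integrable_mult_partial_test_function:
  assumes "open \<Omega>" "locally_integrable \<Omega> f" "test_function \<Omega> \<phi>"
  shows "integrable (lebesgue_on \<Omega>) (\<lambda>x. f x * partial i \<phi> x)"
proof (rule integrable_mult_compact_support[where K = "closure {x. \<phi> x \<noteq> 0}"])
  show "continuous_on UNIV (partial i \<phi>)"
    using test_function_C_k[OF assms(3), of 1] by simp
  \<comment> \<open>The complement of the support is open, so near such a point the test function is
    constantly 0 and so is its derivative.\<close>
  show "partial i \<phi> x = 0" if x: "x \<notin> closure {x. \<phi> x \<noteq> 0}" for x
  proof -
    have "(\<phi> has_derivative (\<lambda>_. 0)) (at x)"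
      by (rule has_derivative_transform_within_open[of "\<lambda>_. 0" _ _ _ "- closure {x. \<phi> x \<noteq> 0}"])
        (use x closure_subset[of "{x. \<phi> x \<noteq> 0}"] in auto)
    then show ?thesis by (rule partial_eqI)
  qed
qed (use assms in \<open>auto simp: test_function_def\<close>)

text \<open>Against a test function, each component of either gradient gives minus the integral of
  \<open>u\<close> times a partial derivative. The difference of the components is therefore
  orthogonal to all test functions, and there are finitely many components.\<close>

lemma weak_gradient_unique:
  assumes \<Omega>: "open \<Omega>" and G: "has_weak_gradient \<Omega> u G" and H: "has_weak_gradient \<Omega> u H"
  shows "AE x in lebesgue_on \<Omega>. G x = H x"
proof -
  have "AE x in lebesgue_on \<Omega>. G x $ i - H x $ i = 0" for i
  proof (rule fundamental_lemma_calculus_of_variations[OF \<Omega>])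
    have Gi: "locally_integrable \<Omega> (\<lambda>x. G x $ i)" and Hi: "locally_integrable \<Omega> (\<lambda>x. H x $ i)"
      using G H by (auto simp: has_weak_gradient_def intro: locally_integrable_component)
    show "locally_integrable \<Omega> (\<lambda>x. G x $ i - H x $ i)"
      by (rule locally_integrable_diff[OF Gi Hi])
    fix \<phi> assume \<phi>: "test_function \<Omega> \<phi>"
    have "(\<integral>x. G x $ i * \<phi> x \<partial>lebesgue_on \<Omega>) = (\<integral>x. H x $ i * \<phi> x \<partial>lebesgue_on \<Omega>)"
      using G H \<phi> by (auto simp: has_weak_gradient_def)
    then show "(\<integral>x. (G x $ i - H x $ i) * \<phi> x \<partial>lebesgue_on \<Omega>) = 0"
      using integrable_mult_test_function[OF \<Omega> Gi \<phi>] integrable_mult_test_function[OF \<Omega> Hi \<phi>]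
      by (simp add: left_diff_distrib)
  qed
  then have "AE x in lebesgue_on \<Omega>. \<forall>i\<in>UNIV. G x $ i - H x $ i = 0"
    by (intro AE_finite_allI) auto
  then show ?thesis by eventually_elim (simp add: vec_eq_iff)
qed

lemma has_weak_gradient_diff:
  assumes \<Omega>: "open \<Omega>" and G: "has_weak_gradient \<Omega> u G" and H: "has_weak_gradient \<Omega> v H"
  shows "has_weak_gradient \<Omega> (\<lambda>x. u x - v x) (\<lambda>x. G x - H x)"
  unfolding has_weak_gradient_def
proof (intro conjI allI impI)
  have uv: "locally_integrable \<Omega> u" "locally_integrable \<Omega> v"
    and GH: "locally_integrable \<Omega> G" "locally_integrable \<Omega> H"
    using G H by (auto simp: has_weak_gradient_def)
  then show "locally_integrable \<Omega> (\<lambda>x. u x - v x)" "locally_integrable \<Omega> (\<lambda>x. G x - H x)"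
    by (auto intro: locally_integrable_diff)
  fix \<phi> i assume \<phi>: "test_function \<Omega> \<phi>"
  note [simp] = integrable_mult_partial_test_function[OF \<Omega> uv(1) \<phi>]
    integrable_mult_partial_test_function[OF \<Omega> uv(2) \<phi>]
    integrable_mult_test_function[OF \<Omega> locally_integrable_component[OF GH(1)] \<phi>]
    integrable_mult_test_function[OF \<Omega> locally_integrable_component[OF GH(2)] \<phi>]
  show "(\<integral>x. (u x - v x) * partial i \<phi> x \<partial>lebesgue_on \<Omega>)
      = - (\<integral>x. (G x - H x) $ i * \<phi> x \<partial>lebesgue_on \<Omega>)"
    using G H \<phi> by (simp add: left_diff_distrib has_weak_gradient_def)
qed

section \<open>Lebesgue and Sobolev spaces, traces\<close>

lemma powr_2_nonneg: "0 \<le> x \<Longrightarrow> x powr 2 = x\<^sup>2" for x :: real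
  by (cases "x = 0") auto

lemma Lp_norm_nonneg: "0 \<le> Lp_norm \<Omega> p f"
  by (simp add: Lp_norm_def)

lemma Lp_norm_powr:
  assumes "p > 0"
  shows "Lp_norm \<Omega> p f powr p = (\<integral>x. norm (f x) powr p \<partial>lebesgue_on \<Omega>)"
  using assms by (simp add: Lp_norm_def powr_powr)

lemma Lp_norm_2_squared: "(Lp_norm \<Omega> 2 f)\<^sup>2 = (\<integral>x. (norm (f x))\<^sup>2 \<partial>lebesgue_on \<Omega>)"
  using Lp_norm_powr[of 2 \<Omega> f] by (simp add: powr_2_nonneg Lp_norm_nonneg)

lemma Lp_space_2_iff:
  "f \<in> Lp_space \<Omega> 2 \<longleftrightarrow> f \<in> borel_measurable (lebesgue_on \<Omega>) \<and>
    integrable (lebesgue_on \<Omega>) (\<lambda>x. (norm (f x))\<^sup>2)"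
  by (simp add: Lp_space_def powr_2_nonneg)

lemma Lp_space_cong_AE:
  assumes "f \<in> Lp_space \<Omega> p" "g \<in> borel_measurable (lebesgue_on \<Omega>)"
    and "AE x in lebesgue_on \<Omega>. f x = g x"
  shows "g \<in> Lp_space \<Omega> p"
proof -
  have [measurable]: "f \<in> borel_measurable (lebesgue_on \<Omega>)" "g \<in> borel_measurable (lebesgue_on \<Omega>)"
    using assms by (auto simp: Lp_space_def)
  have "AE x in lebesgue_on \<Omega>. norm (f x) powr p = norm (g x) powr p"
    using assms(3) by eventually_elim simp
  moreover have "integrable (lebesgue_on \<Omega>) (\<lambda>x. norm (f x) powr p)"
    using assms(1) by (simp add: Lp_space_def)
  ultimately have "integrable (lebesgue_on \<Omega>) (\<lambda>x. norm (g x) powr p)"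
    by (subst (asm) integrable_cong_AE) auto
  then show ?thesis by (simp add: Lp_space_def)
qed

lemma Lp_norm_cong_AE:
  assumes "f \<in> borel_measurable (lebesgue_on \<Omega>)" "g \<in> borel_measurable (lebesgue_on \<Omega>)"
    and "AE x in lebesgue_on \<Omega>. f x = g x"
  shows "Lp_norm \<Omega> p f = Lp_norm \<Omega> p g"
proof -
  note [measurable] = assms(1,2)
  have "AE x in lebesgue_on \<Omega>. norm (f x) powr p = norm (g x) powr p"
    using assms(3) by eventually_elim simp
  then show ?thesis unfolding Lp_norm_def by (subst integral_cong_AE) auto
qed

text \<open>This squared form of the triangle inequality integrates directly and takes the place of
  Minkowski's inequality below, at the price of a harmless constant.\<close>

lemma norm_diff_squared_le: "(norm (a - b))\<^sup>2 \<le> 2 * (norm a)\<^sup>2 + 2 * (norm b)\<^sup>2"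
proof -
  have "(norm (a - b))\<^sup>2 \<le> (norm a + norm b)\<^sup>2"
    by (intro power_mono norm_triangle_ineq4) simp
  also have "\<dots> \<le> 2 * (norm a)\<^sup>2 + 2 * (norm b)\<^sup>2"
    using sum_squares_bound[of "norm a" "norm b"] by (simp add: power2_sum)
  finally show ?thesis .
qed

lemma Lp_space_2_diff:
  assumes "f \<in> Lp_space \<Omega> 2" "g \<in> Lp_space \<Omega> 2"
  shows "(\<lambda>x. f x - g x) \<in> Lp_space \<Omega> 2"
proof -
  have [measurable]: "f \<in> borel_measurable (lebesgue_on \<Omega>)" "g \<in> borel_measurable (lebesgue_on \<Omega>)"
    and fg: "integrable (lebesgue_on \<Omega>) (\<lambda>x. 2 * (norm (f x))\<^sup>2 + 2 * (norm (g x))\<^sup>2)"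
    using assms by (auto simp: Lp_space_2_iff)
  have "integrable (lebesgue_on \<Omega>) (\<lambda>x. (norm (f x - g x))\<^sup>2)"
    by (rule Bochner_Integration.integrable_bound[OF fg])
      (auto intro!: always_eventually abs_le_D1 norm_diff_squared_le[THEN order_trans])
  then show ?thesis by (simp add: Lp_space_2_iff)
qed

lemma Lp_norm_2_diff_squared_le:
  assumes "f \<in> Lp_space \<Omega> 2" "g \<in> Lp_space \<Omega> 2"
  shows "(Lp_norm \<Omega> 2 (\<lambda>x. f x - g x))\<^sup>2 \<le> 2 * (Lp_norm \<Omega> 2 f)\<^sup>2 + 2 * (Lp_norm \<Omega> 2 g)\<^sup>2"
proof -
  have "(\<integral>x. (norm (f x - g x))\<^sup>2 \<partial>lebesgue_on \<Omega>)
    \<le> (\<integral>x. 2 * (norm (f x))\<^sup>2 + 2 * (norm (g x))\<^sup>2 \<partial>lebesgue_on \<Omega>)"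
    using Lp_space_2_diff[OF assms] assms
    by (intro integral_mono norm_diff_squared_le) (auto simp: Lp_space_2_iff)
  also have "\<dots> = 2 * (\<integral>x. (norm (f x))\<^sup>2 \<partial>lebesgue_on \<Omega>) + 2 * (\<integral>x. (norm (g x))\<^sup>2 \<partial>lebesgue_on \<Omega>)"
    using assms by (simp add: Lp_space_2_iff)
  finally show ?thesis by (simp add: Lp_norm_2_squared)
qed

section \<open>The chosen weak gradient and the space H1\<close>

lemma has_weak_gradient_wgrad: "has_weak_gradient \<Omega> u G \<Longrightarrow> has_weak_gradient \<Omega> u (wgrad \<Omega> u)"
  unfolding wgrad_def by (rule someI[of "has_weak_gradient \<Omega> u"])

lemma wgrad_measurable:
  assumes "open \<Omega>" "u \<in> W1_space \<Omega> p"
  shows "wgrad \<Omega> u \<in> borel_measurable (lebesgue_on \<Omega>)"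
proof -
  have "has_weak_gradient \<Omega> u (wgrad \<Omega> u)"
    using assms(2) has_weak_gradient_wgrad by (auto simp: W1_space_def)
  then show ?thesis
    by (intro locally_integrable_measurable assms(1)) (simp add: has_weak_gradient_def)
qed

text \<open>The space provides some weak gradient with finite norm, which need not be the one chosen
  by \<open>wgrad\<close>; by uniqueness the two agree almost everywhere.\<close>

lemma wgrad_in_Lp_space:
  assumes "open \<Omega>" "u \<in> W1_space \<Omega> p"
  shows "wgrad \<Omega> u \<in> Lp_space \<Omega> p"
proof -
  obtain G where G: "G \<in> Lp_space \<Omega> p" "has_weak_gradient \<Omega> u G"
    using assms(2) by (auto simp: W1_space_def)
  show ?thesis
    using Lp_space_cong_AE[OF G(1) wgrad_measurable[OF assms]
        weak_gradient_unique[OF assms(1) G(2) has_weak_gradient_wgrad[OF G(2)]]] .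
qed

text \<open>The difference of the chosen gradients is a weak gradient of the difference; the choice
  made for the difference agrees with it only almost everywhere.\<close>

lemma W1_space_2_diff:
  assumes \<Omega>: "open \<Omega>" and u: "u \<in> H1 \<Omega>" and v: "v \<in> H1 \<Omega>"
  shows "(\<lambda>x. u x - v x) \<in> H1 \<Omega>"
    and "AE x in lebesgue_on \<Omega>. wgrad \<Omega> (\<lambda>x. u x - v x) x = wgrad \<Omega> u x - wgrad \<Omega> v x"
proof -
  have D: "has_weak_gradient \<Omega> (\<lambda>x. u x - v x) (\<lambda>x. wgrad \<Omega> u x - wgrad \<Omega> v x)"
    using u v has_weak_gradient_wgrad
    by (intro has_weak_gradient_diff[OF \<Omega>]) (auto simp: W1_space_def)
  moreover have "(\<lambda>x. wgrad \<Omega> u x - wgrad \<Omega> v x) \<in> Lp_space \<Omega> 2"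
    using u v by (intro Lp_space_2_diff wgrad_in_Lp_space \<Omega>)
  moreover have "(\<lambda>x. u x - v x) \<in> Lp_space \<Omega> 2"
    using u v by (intro Lp_space_2_diff) (auto simp: W1_space_def)
  ultimately show "(\<lambda>x. u x - v x) \<in> H1 \<Omega>" by (auto simp: W1_space_def)
  show "AE x in lebesgue_on \<Omega>. wgrad \<Omega> (\<lambda>x. u x - v x) x = wgrad \<Omega> u x - wgrad \<Omega> v x"
    by (rule weak_gradient_unique[OF \<Omega> has_weak_gradient_wgrad[OF D] D])
qed

lemma Lp_norm_wgrad_diff:
  assumes \<Omega>: "open \<Omega>" and u: "u \<in> H1 \<Omega>" and v: "v \<in> H1 \<Omega>"
  shows "Lp_norm \<Omega> p (wgrad \<Omega> (\<lambda>x. u x - v x)) = Lp_norm \<Omega> p (\<lambda>x. wgrad \<Omega> u x - wgrad \<Omega> v x)"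
  using wgrad_measurable[OF \<Omega> u] wgrad_measurable[OF \<Omega> v]
  by (intro Lp_norm_cong_AE W1_space_2_diff[OF assms] wgrad_measurable[OF \<Omega> W1_space_2_diff(1)[OF assms]]
      borel_measurable_diff)

text \<open>The definition sums the norms of the components of the gradient. For exponent 2 this sum
  is exactly the squared norm of the gradient vector, by summing squares under the integral.\<close>

lemma H1_norm_squared:
  assumes \<Omega>: "open \<Omega>" and u: "u \<in> H1 \<Omega>"
  shows "(H1_norm \<Omega> u)\<^sup>2 = (Lp_norm \<Omega> 2 u)\<^sup>2 + (Lp_norm \<Omega> 2 (wgrad \<Omega> u))\<^sup>2"
proof -
  let ?S = "\<Sum>i\<in>UNIV. (Lp_norm \<Omega> 2 (\<lambda>x. wgrad \<Omega> u x $ i))\<^sup>2"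
  have G: "wgrad \<Omega> u \<in> borel_measurable (lebesgue_on \<Omega>)"
    "integrable (lebesgue_on \<Omega>) (\<lambda>x. (norm (wgrad \<Omega> u x))\<^sup>2)"
    using wgrad_in_Lp_space[OF \<Omega> u] by (auto simp: Lp_space_2_iff)
  have Gi: "integrable (lebesgue_on \<Omega>) (\<lambda>x. (norm (wgrad \<Omega> u x $ i))\<^sup>2)" for i
  proof (rule Bochner_Integration.integrable_bound[OF G(2)])
    have "(\<lambda>x. wgrad \<Omega> u x $ i) \<in> borel_measurable (lebesgue_on \<Omega>)"
      by (rule measurable_compose[OF G(1)]) (auto intro!: borel_measurable_continuous_onI continuous_intros)
    then show "(\<lambda>x. (norm (wgrad \<Omega> u x $ i))\<^sup>2) \<in> borel_measurable (lebesgue_on \<Omega>)" by simp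
    show "AE x in lebesgue_on \<Omega>. norm ((norm (wgrad \<Omega> u x $ i))\<^sup>2) \<le> norm ((norm (wgrad \<Omega> u x))\<^sup>2)"
    proof (intro always_eventually allI)
      fix x
      show "norm ((norm (wgrad \<Omega> u x $ i))\<^sup>2) \<le> norm ((norm (wgrad \<Omega> u x))\<^sup>2)"
        using power_mono[OF component_le_norm_cart[of "wgrad \<Omega> u x" i], of 2] by simp
    qed
  qed
  have "?S = (\<Sum>i\<in>UNIV. \<integral>x. (norm (wgrad \<Omega> u x $ i))\<^sup>2 \<partial>lebesgue_on \<Omega>)"
    by (simp add: Lp_norm_2_squared del: real_norm_def)
  also have "\<dots> = (\<integral>x. (\<Sum>i\<in>UNIV. (norm (wgrad \<Omega> u x $ i))\<^sup>2) \<partial>lebesgue_on \<Omega>)"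
    by (rule Bochner_Integration.integral_sum[symmetric]) (rule Gi)
  also have "\<dots> = (Lp_norm \<Omega> 2 (wgrad \<Omega> u))\<^sup>2"
    by (simp add: Lp_norm_2_squared norm_vec_def L2_set_def sum_nonneg)
  finally have S: "?S = (Lp_norm \<Omega> 2 (wgrad \<Omega> u))\<^sup>2" .
  have "H1_norm \<Omega> u = ((Lp_norm \<Omega> 2 u)\<^sup>2 + ?S) powr (1 / 2)"
    by (simp add: W1_norm_def powr_2_nonneg Lp_norm_nonneg)
  then show ?thesis
    unfolding S by (simp add: powr_half_sqrt)
qed

lemma W1_norm_nonneg: "0 \<le> W1_norm \<Omega> p u"
  by (simp add: W1_norm_def)

lemma H1_norm_diff_squared_le:
  assumes \<Omega>: "open \<Omega>" and u: "u \<in> H1 \<Omega>" and v: "v \<in> H1 \<Omega>"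
  shows "(H1_norm \<Omega> (\<lambda>x. u x - v x))\<^sup>2 \<le> 2 * (H1_norm \<Omega> u)\<^sup>2 + 2 * (H1_norm \<Omega> v)\<^sup>2"
proof -
  have "(Lp_norm \<Omega> 2 (\<lambda>x. u x - v x))\<^sup>2 \<le> 2 * (Lp_norm \<Omega> 2 u)\<^sup>2 + 2 * (Lp_norm \<Omega> 2 v)\<^sup>2"
    using u v by (intro Lp_norm_2_diff_squared_le) (auto simp: W1_space_def)
  moreover have "(Lp_norm \<Omega> 2 (wgrad \<Omega> (\<lambda>x. u x - v x)))\<^sup>2
      \<le> 2 * (Lp_norm \<Omega> 2 (wgrad \<Omega> u))\<^sup>2 + 2 * (Lp_norm \<Omega> 2 (wgrad \<Omega> v))\<^sup>2"
    unfolding Lp_norm_wgrad_diff[OF assms]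
    by (intro Lp_norm_2_diff_squared_le wgrad_in_Lp_space \<Omega> u v)
  ultimately show ?thesis
    unfolding H1_norm_squared[OF \<Omega> u] H1_norm_squared[OF \<Omega> v]
      H1_norm_squared[OF \<Omega> W1_space_2_diff(1)[OF assms]]
    by argo
qed

section \<open>The boundary measure and traces\<close>

lemma sets_boundary_measure: "sets (boundary_measure \<Omega>) = sets (restrict_space borel (frontier \<Omega>))"
  \<comment> \<open>The sigma-algebra of \<open>measure_of\<close> comes from its generating sets,
    whatever the set function.\<close>
  unfolding boundary_measure_def
  by (intro sets_restrict_space_cong) (metis sets.sets_measure_of_eq space_borel)

lemma continuous_on_closure_measurable_boundary:
  fixes W :: "real^2 \<Rightarrow> real"
  assumes "continuous_on (closure \<Omega>) W"
  shows "W \<in> borel_measurable (boundary_measure \<Omega>)"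
proof -
  have "continuous_on (frontier \<Omega>) W"
    using assms by (rule continuous_on_subset) (simp add: frontier_def)
  then show ?thesis
    using borel_measurable_continuous_on_restrict measurable_cong_sets[OF sets_boundary_measure refl]
    by blast
qed

text \<open>The differences of the two approximating sequences approximate the difference. Both
  convergences follow by squeezing, with the squared triangle inequality as upper bound.\<close>

lemma has_trace_diff:
  assumes \<Omega>: "open \<Omega>" and w: "w\<^sub>1 \<in> H1 \<Omega>" "w\<^sub>2 \<in> H1 \<Omega>"
    and t: "has_trace \<Omega> w\<^sub>1 t\<^sub>1" "has_trace \<Omega> w\<^sub>2 t\<^sub>2"
  shows "has_trace \<Omega> (\<lambda>x. w\<^sub>1 x - w\<^sub>2 x) (\<lambda>x. t\<^sub>1 x - t\<^sub>2 x)"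
proof -
  let ?B = "boundary_measure \<Omega>"
  have tm [measurable]: "t\<^sub>1 \<in> borel_measurable ?B" "t\<^sub>2 \<in> borel_measurable ?B"
    and ti: "integrable ?B (\<lambda>x. (t\<^sub>1 x)\<^sup>2)" "integrable ?B (\<lambda>x. (t\<^sub>2 x)\<^sup>2)"
    using t by (auto simp: has_trace_def)
  obtain W\<^sub>1 where W1: "\<And>n. W\<^sub>1 n \<in> H1 \<Omega> \<and> continuous_on (closure \<Omega>) (W\<^sub>1 n)"
    "(\<lambda>n. H1_norm \<Omega> (\<lambda>x. W\<^sub>1 n x - w\<^sub>1 x)) \<longlonglongrightarrow> 0"
    "(\<lambda>n. \<integral>\<^sup>+x. ennreal ((W\<^sub>1 n x - t\<^sub>1 x)\<^sup>2) \<partial>?B) \<longlonglongrightarrow> 0"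
    using t(1) unfolding has_trace_def by blast
  obtain W\<^sub>2 where W2: "\<And>n. W\<^sub>2 n \<in> H1 \<Omega> \<and> continuous_on (closure \<Omega>) (W\<^sub>2 n)"
    "(\<lambda>n. H1_norm \<Omega> (\<lambda>x. W\<^sub>2 n x - w\<^sub>2 x)) \<longlonglongrightarrow> 0"
    "(\<lambda>n. \<integral>\<^sup>+x. ennreal ((W\<^sub>2 n x - t\<^sub>2 x)\<^sup>2) \<partial>?B) \<longlonglongrightarrow> 0"
    using t(2) unfolding has_trace_def by blast
  have [measurable]: "W\<^sub>1 n \<in> borel_measurable ?B" "W\<^sub>2 n \<in> borel_measurable ?B" for n
    using W1(1) W2(1) continuous_on_closure_measurable_boundary by blast+
  have sq: "((a - b) - (c - d))\<^sup>2 \<le> 2 * (a - c)\<^sup>2 + 2 * (b - d)\<^sup>2" for a b c d :: real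
    using norm_diff_squared_le[of "a - c" "b - d"] by (simp add: algebra_simps)
  let ?W = "\<lambda>n x. W\<^sub>1 n x - W\<^sub>2 n x"
  have "integrable ?B (\<lambda>x. (t\<^sub>1 x - t\<^sub>2 x)\<^sup>2)"
  proof (rule Bochner_Integration.integrable_bound)
    show "integrable ?B (\<lambda>x. 2 * (t\<^sub>1 x)\<^sup>2 + 2 * (t\<^sub>2 x)\<^sup>2)" using ti by simp
    show "AE x in ?B. norm ((t\<^sub>1 x - t\<^sub>2 x)\<^sup>2) \<le> norm (2 * (t\<^sub>1 x)\<^sup>2 + 2 * (t\<^sub>2 x)\<^sup>2)"
      using sq[of "t\<^sub>1 _" "t\<^sub>2 _" 0 0] by (auto intro!: always_eventually)
  qed simp
  moreover have "?W n \<in> H1 \<Omega> \<and> continuous_on (closure \<Omega>) (?W n)" for n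
    using W1(1) W2(1) W1_space_2_diff(1)[OF \<Omega>] by (auto intro!: continuous_intros)
  moreover have "(\<lambda>n. H1_norm \<Omega> (\<lambda>x. ?W n x - (w\<^sub>1 x - w\<^sub>2 x))) \<longlonglongrightarrow> 0"
  proof (rule tendsto_sandwich[where f = "\<lambda>_. 0"])
    let ?b = "\<lambda>n. sqrt (2 * (H1_norm \<Omega> (\<lambda>x. W\<^sub>1 n x - w\<^sub>1 x))\<^sup>2 + 2 * (H1_norm \<Omega> (\<lambda>x. W\<^sub>2 n x - w\<^sub>2 x))\<^sup>2)"
    show "\<forall>\<^sub>F n in sequentially. H1_norm \<Omega> (\<lambda>x. ?W n x - (w\<^sub>1 x - w\<^sub>2 x)) \<le> ?b n"
    proof (intro always_eventually allI real_le_rsqrt)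
      fix n
      have eq: "(\<lambda>x. ?W n x - (w\<^sub>1 x - w\<^sub>2 x)) = (\<lambda>x. (W\<^sub>1 n x - w\<^sub>1 x) - (W\<^sub>2 n x - w\<^sub>2 x))" by auto
      show "(H1_norm \<Omega> (\<lambda>x. ?W n x - (w\<^sub>1 x - w\<^sub>2 x)))\<^sup>2 \<le> 2 * (H1_norm \<Omega> (\<lambda>x. W\<^sub>1 n x - w\<^sub>1 x))\<^sup>2
          + 2 * (H1_norm \<Omega> (\<lambda>x. W\<^sub>2 n x - w\<^sub>2 x))\<^sup>2"
        unfolding eq using W1(1) W2(1) w
        by (intro H1_norm_diff_squared_le W1_space_2_diff(1) \<Omega>) auto
    qed
    have "?b \<longlonglongrightarrow> sqrt (2 * 0\<^sup>2 + 2 * 0\<^sup>2)"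
      by (intro tendsto_intros W1 W2)
    then show "?b \<longlonglongrightarrow> 0" by simp
  qed (auto simp: W1_norm_nonneg)
  moreover have "(\<lambda>n. \<integral>\<^sup>+x. ennreal ((?W n x - (t\<^sub>1 x - t\<^sub>2 x))\<^sup>2) \<partial>?B) \<longlonglongrightarrow> 0"
  proof (rule tendsto_sandwich[where f = "\<lambda>_. 0"])
    let ?b = "\<lambda>n. 2 * (\<integral>\<^sup>+x. ennreal ((W\<^sub>1 n x - t\<^sub>1 x)\<^sup>2) \<partial>?B) + 2 * (\<integral>\<^sup>+x. ennreal ((W\<^sub>2 n x - t\<^sub>2 x)\<^sup>2) \<partial>?B)"
    show "\<forall>\<^sub>F n in sequentially. (\<integral>\<^sup>+x. ennreal ((?W n x - (t\<^sub>1 x - t\<^sub>2 x))\<^sup>2) \<partial>?B) \<le> ?b n"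
    proof (intro always_eventually allI)
      fix n
      have "(\<integral>\<^sup>+x. ennreal ((?W n x - (t\<^sub>1 x - t\<^sub>2 x))\<^sup>2) \<partial>?B)
        \<le> (\<integral>\<^sup>+x. 2 * ennreal ((W\<^sub>1 n x - t\<^sub>1 x)\<^sup>2) + 2 * ennreal ((W\<^sub>2 n x - t\<^sub>2 x)\<^sup>2) \<partial>?B)"
      proof (rule nn_integral_mono)
        fix x
        have "ennreal ((?W n x - (t\<^sub>1 x - t\<^sub>2 x))\<^sup>2) \<le> ennreal (2 * (W\<^sub>1 n x - t\<^sub>1 x)\<^sup>2 + 2 * (W\<^sub>2 n x - t\<^sub>2 x)\<^sup>2)"
          by (intro ennreal_leI sq)
        then show "ennreal ((?W n x - (t\<^sub>1 x - t\<^sub>2 x))\<^sup>2) \<le> 2 * ennreal ((W\<^sub>1 n x - t\<^sub>1 x)\<^sup>2) + 2 * ennreal ((W\<^sub>2 n x - t\<^sub>2 x)\<^sup>2)"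
          by (simp add: ennreal_plus ennreal_mult)
      qed
      also have "\<dots> = ?b n"
        by (subst nn_integral_add) (auto simp: nn_integral_cmult)
      finally show "(\<integral>\<^sup>+x. ennreal ((?W n x - (t\<^sub>1 x - t\<^sub>2 x))\<^sup>2) \<partial>?B) \<le> ?b n" .
    qed
    have "?b \<longlonglongrightarrow> 2 * 0 + 2 * 0"
      by (intro tendsto_add ennreal_tendsto_cmult W1 W2) auto
    then show "?b \<longlonglongrightarrow> 0" by simp
  qed auto
  ultimately show ?thesis
    unfolding has_trace_def by (intro conjI exI[of _ ?W]) auto
qed

text \<open>This makes the difference of two solutions admissible as a test function, and lets the
  Poincare inequality be applied to the difference of the coefficient arguments.\<close>

lemma H1D_diff:
  assumes \<Omega>: "open \<Omega>" and w: "w\<^sub>1 \<in> H1D \<Omega> \<Gamma>" "w\<^sub>2 \<in> H1D \<Omega> \<Gamma>"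
  shows "(\<lambda>x. w\<^sub>1 x - w\<^sub>2 x) \<in> H1D \<Omega> \<Gamma>"
proof -
  obtain t\<^sub>1 t\<^sub>2 where t: "has_trace \<Omega> w\<^sub>1 t\<^sub>1" "has_trace \<Omega> w\<^sub>2 t\<^sub>2"
    "AE x in boundary_measure \<Omega>. x \<in> \<Gamma> \<longrightarrow> t\<^sub>1 x = 0" "AE x in boundary_measure \<Omega>. x \<in> \<Gamma> \<longrightarrow> t\<^sub>2 x = 0"
    using w by (auto simp: H1D_def)
  have "AE x in boundary_measure \<Omega>. x \<in> \<Gamma> \<longrightarrow> t\<^sub>1 x - t\<^sub>2 x = 0"
    using t(3,4) by eventually_elim auto
  then show ?thesis
    using has_trace_diff[OF \<Omega> _ _ t(1,2)] W1_space_2_diff(1)[OF \<Omega>] w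
    unfolding H1D_def by blast
qed

section \<open>Hoelder's inequality\<close>

text \<open>Young's inequality bounds the product pointwise, which gives integrability; applied to
  the normalised functions \<open>f x / A\<close> and \<open>g x / B\<close> and integrated, it
  gives the sharp constant.\<close>

lemma Holder_inequality:
  fixes f g :: "'a \<Rightarrow> real"
  assumes p: "p > 1" "q > 1" "1 / p + 1 / q = 1"
    and meas [measurable]: "f \<in> borel_measurable M" "g \<in> borel_measurable M"
    and nonneg: "\<And>x. 0 \<le> f x" "\<And>x. 0 \<le> g x"
    and int: "integrable M (\<lambda>x. f x powr p)" "integrable M (\<lambda>x. g x powr q)"
  shows "integrable M (\<lambda>x. f x * g x)"
    and "(\<integral>x. f x * g x \<partial>M) \<le> (\<integral>x. f x powr p \<partial>M) powr (1 / p) * (\<integral>x. g x powr q \<partial>M) powr (1 / q)"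
proof -
  define A where "A = (\<integral>x. f x powr p \<partial>M) powr (1 / p)"
  define B where "B = (\<integral>x. g x powr q \<partial>M) powr (1 / q)"
  have Ap: "A powr p = (\<integral>x. f x powr p \<partial>M)" and Bq: "B powr q = (\<integral>x. g x powr q \<partial>M)"
    using p by (simp_all add: A_def B_def powr_powr)
  show fg: "integrable M (\<lambda>x. f x * g x)"
  proof (rule Bochner_Integration.integrable_bound)
    show "integrable M (\<lambda>x. f x powr p / p + g x powr q / q)" using int by simp
    show "AE x in M. norm (f x * g x) \<le> norm (f x powr p / p + g x powr q / q)"
    proof (intro always_eventually allI)
      fix x
      have "f x * g x \<le> f x powr p / p + g x powr q / q"
        by (rule Youngs_inequality[OF p nonneg])
      moreover have "0 \<le> f x * g x" using nonneg by simp
      ultimately show "norm (f x * g x) \<le> norm (f x powr p / p + g x powr q / q)" by simp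
    qed
  qed measurable
  have "(\<integral>x. f x * g x \<partial>M) \<le> A * B"
  \<comment> \<open>Normalisation divides by \<open>A * B\<close>. If a norm is 0, that function
    vanishes almost everywhere and so does the product.\<close>
  proof (cases "A = 0 \<or> B = 0")
    case True
    have "AE x in M. f x * g x = 0"
    proof (cases "A = 0")
      case True
      then have "(\<integral>x. f x powr p \<partial>M) = 0" using Ap p by simp
      then have "AE x in M. f x powr p = 0"
        using int by (subst (asm) integral_nonneg_eq_0_iff_AE) auto
      then show ?thesis by eventually_elim simp
    next
      case False
      then have "(\<integral>x. g x powr q \<partial>M) = 0" using Bq p \<open>A = 0 \<or> B = 0\<close> by simp
      then have "AE x in M. g x powr q = 0"
        using int by (subst (asm) integral_nonneg_eq_0_iff_AE) auto
      then show ?thesis by eventually_elim simp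
    qed
    then have "(\<integral>x. f x * g x \<partial>M) = 0" by (rule integral_eq_zero_AE)
    then show ?thesis by (simp add: A_def B_def)
  next
    case False
    then have pos: "A > 0" "B > 0" by (auto simp: A_def B_def less_le)
    have "(\<integral>x. f x * g x \<partial>M) / (A * B) = (\<integral>x. (f x / A) * (g x / B) \<partial>M)"
      by simp
    also have "\<dots> \<le> (\<integral>x. f x powr p / (p * A powr p) + g x powr q / (q * B powr q) \<partial>M)"
    proof (rule integral_mono)
      show "integrable M (\<lambda>x. f x / A * (g x / B))" using fg by simp
      show "integrable M (\<lambda>x. f x powr p / (p * A powr p) + g x powr q / (q * B powr q))"
        using int by simp
      fix x
      show "f x / A * (g x / B) \<le> f x powr p / (p * A powr p) + g x powr q / (q * B powr q)"
        using Youngs_inequality[OF p, of "f x / A" "g x / B"] nonneg[of x] pos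
        by (simp add: powr_divide mult.commute)
    qed
    also have "\<dots> = A powr p / (p * A powr p) + B powr q / (q * B powr q)"
      using int by (simp add: Ap Bq)
    also have "\<dots> = 1" using p pos by (simp add: field_simps)
    finally show ?thesis using pos by (simp add: field_simps)
  qed
  then show "(\<integral>x. f x * g x \<partial>M) \<le> (\<integral>x. f x powr p \<partial>M) powr (1 / p) * (\<integral>x. g x powr q \<partial>M) powr (1 / q)"
    by (simp add: A_def B_def)
qed

text \<open>Hoelder's inequality is applied to the squared norms with exponents \<open>s / 2\<close>
  and \<open>r / 2\<close>, which are conjugate precisely because
  \<open>1 / r + 1 / s = 1 / 2\<close>.\<close>

lemma Lp_norm_scaleR_le:
  fixes z :: "'a::euclidean_space \<Rightarrow> real" and v :: "'a \<Rightarrow> 'b::euclidean_space"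
  assumes rs: "r > 2" "s > 2" "1 / r + 1 / s = 1 / 2"
    and z: "z \<in> Lp_space \<Omega> s" and v: "v \<in> Lp_space \<Omega> r"
  shows "(\<lambda>x. z x *\<^sub>R v x) \<in> Lp_space \<Omega> 2"
    and "Lp_norm \<Omega> 2 (\<lambda>x. z x *\<^sub>R v x) \<le> Lp_norm \<Omega> s z * Lp_norm \<Omega> r v"
proof -
  let ?M = "lebesgue_on \<Omega>"
  have [measurable]: "z \<in> borel_measurable ?M" "v \<in> borel_measurable ?M"
    and zi: "integrable ?M (\<lambda>x. norm (z x) powr s)" and vi: "integrable ?M (\<lambda>x. norm (v x) powr r)"
    using z v by (auto simp: Lp_space_def)
  have pw: "(norm a)\<^sup>2 powr (t / 2) = norm a powr t" for a :: "'c::real_normed_vector" and t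
    unfolding powr_2_nonneg[OF norm_ge_zero, symmetric] powr_powr by simp
  have pq: "s / 2 > 1" "r / 2 > 1" "1 / (s / 2) + 1 / (r / 2) = 1"
    using rs by auto
  have H: "integrable ?M (\<lambda>x. (norm (z x))\<^sup>2 * (norm (v x))\<^sup>2)"
    "(\<integral>x. (norm (z x))\<^sup>2 * (norm (v x))\<^sup>2 \<partial>?M)
      \<le> (\<integral>x. norm (z x) powr s \<partial>?M) powr (1 / (s / 2)) * (\<integral>x. norm (v x) powr r \<partial>?M) powr (1 / (r / 2))"
    using Holder_inequality[OF pq, of "\<lambda>x. (norm (z x))\<^sup>2" ?M "\<lambda>x. (norm (v x))\<^sup>2"] zi vi
    unfolding pw by auto
  have eq: "(norm (z x *\<^sub>R v x))\<^sup>2 = (norm (z x))\<^sup>2 * (norm (v x))\<^sup>2" for x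
    by (simp add: power_mult_distrib)
  show "(\<lambda>x. z x *\<^sub>R v x) \<in> Lp_space \<Omega> 2"
    using H(1) unfolding Lp_space_2_iff eq by simp
  have "(Lp_norm \<Omega> 2 (\<lambda>x. z x *\<^sub>R v x))\<^sup>2 \<le> (Lp_norm \<Omega> s z * Lp_norm \<Omega> r v)\<^sup>2"
    unfolding Lp_norm_2_squared eq power_mult_distrib
      powr_2_nonneg[OF Lp_norm_nonneg, of \<Omega> s, symmetric] powr_2_nonneg[OF Lp_norm_nonneg, of \<Omega> r, symmetric]
    using H(2) by (simp add: Lp_norm_def powr_powr)
  then show "Lp_norm \<Omega> 2 (\<lambda>x. z x *\<^sub>R v x) \<le> Lp_norm \<Omega> s z * Lp_norm \<Omega> r v"
    by (rule power2_le_imp_le) (simp add: Lp_norm_nonneg)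
qed

text \<open>In the plane the norm is at most twice the larger component in absolute value, and the
  power of that component is one of the summands.\<close>

lemma norm_powr_le_sum_components:
  fixes v :: "real^2"
  assumes "r \<ge> 0"
  shows "norm v powr r \<le> 2 powr r * (\<Sum>i\<in>UNIV. norm (v $ i) powr r)"
proof -
  define m where "m = max \<bar>v $ 1\<bar> \<bar>v $ 2\<bar>"
  have "norm v \<le> 2 * m"
    using norm_le_l1_cart[of v] by (simp add: sum_2 m_def)
  then have "norm v powr r \<le> (2 * m) powr r"
    using assms by (intro powr_mono2) auto
  also have "\<dots> = 2 powr r * m powr r"
    by (intro powr_mult)
  also have "m powr r \<le> (\<Sum>i\<in>UNIV. norm (v $ i) powr r)"
    by (simp add: m_def sum_2 max_def)
  finally show ?thesis by simp
qed

text \<open>Hoelder's inequality involves the Euclidean length of the gradient, the Sobolev norm its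
  components. The pointwise factor \<open>2 powr r\<close> becomes 2 after taking the root.\<close>

lemma Lp_norm_wgrad_le_W1_norm:
  fixes u :: "real^2 \<Rightarrow> real"
  assumes \<Omega>: "open \<Omega>" and u: "u \<in> W1_space \<Omega> r" and r: "r > 0"
  shows "Lp_norm \<Omega> r (wgrad \<Omega> u) \<le> 2 * W1_norm \<Omega> r u"
proof -
  let ?M = "lebesgue_on \<Omega>"
  let ?S = "\<Sum>i\<in>UNIV. Lp_norm \<Omega> r (\<lambda>x. wgrad \<Omega> u x $ i) powr r"
  have G: "wgrad \<Omega> u \<in> borel_measurable ?M" "integrable ?M (\<lambda>x. norm (wgrad \<Omega> u x) powr r)"
    using wgrad_in_Lp_space[OF \<Omega> u] by (auto simp: Lp_space_def)
  have Gi: "integrable ?M (\<lambda>x. norm (wgrad \<Omega> u x $ i) powr r)" for i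
  proof (rule Bochner_Integration.integrable_bound[OF G(2)])
    have [measurable]: "(\<lambda>x. wgrad \<Omega> u x $ i) \<in> borel_measurable ?M"
      by (rule measurable_compose[OF G(1)]) (auto intro!: borel_measurable_continuous_onI continuous_intros)
    show "(\<lambda>x. norm (wgrad \<Omega> u x $ i) powr r) \<in> borel_measurable ?M" by measurable
    show "AE x in ?M. norm (norm (wgrad \<Omega> u x $ i) powr r) \<le> norm (norm (wgrad \<Omega> u x) powr r)"
      using r by (auto intro!: always_eventually powr_mono2 component_le_norm_cart)
  qed
  have "(\<integral>x. norm (wgrad \<Omega> u x) powr r \<partial>?M)
      \<le> (\<integral>x. 2 powr r * (\<Sum>i\<in>UNIV. norm (wgrad \<Omega> u x $ i) powr r) \<partial>?M)"
    using G(2) Gi r by (intro integral_mono norm_powr_le_sum_components) auto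
  also have "\<dots> = 2 powr r * ?S"
    using Gi by (simp add: Lp_norm_powr[OF r] Bochner_Integration.integral_sum)
  also have "\<dots> \<le> 2 powr r * (Lp_norm \<Omega> r u powr r + ?S)"
    by simp
  finally have "Lp_norm \<Omega> r (wgrad \<Omega> u) \<le> (2 powr r * (Lp_norm \<Omega> r u powr r + ?S)) powr (1 / r)"
    unfolding Lp_norm_def[of \<Omega> r "wgrad \<Omega> u"] using r by (intro powr_mono2) auto
  also have "\<dots> = 2 * W1_norm \<Omega> r u"
    using r by (subst powr_mult) (auto simp: W1_norm_def powr_powr sum_nonneg)
  finally show ?thesis .
qed

section \<open>Stability estimates\<close>

lemma Lp_space_2_bound:
  assumes f: "f \<in> borel_measurable (lebesgue_on \<Omega>)" and g: "g \<in> Lp_space \<Omega> 2"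
    and K: "K \<ge> 0" and le: "\<And>x. norm (f x) \<le> K * norm (g x)"
  shows "f \<in> Lp_space \<Omega> 2" and "Lp_norm \<Omega> 2 f \<le> K * Lp_norm \<Omega> 2 g"
proof -
  have sq: "(norm (f x))\<^sup>2 \<le> K\<^sup>2 * (norm (g x))\<^sup>2" for x
    using power_mono[OF le, of x 2] by (simp add: power_mult_distrib)
  have gi: "integrable (lebesgue_on \<Omega>) (\<lambda>x. K\<^sup>2 * (norm (g x))\<^sup>2)"
    using g by (simp add: Lp_space_2_iff)
  have "integrable (lebesgue_on \<Omega>) (\<lambda>x. (norm (f x))\<^sup>2)"
    by (rule Bochner_Integration.integrable_bound[OF gi]) (use f sq in auto)
  then show f2: "f \<in> Lp_space \<Omega> 2" using f by (simp add: Lp_space_2_iff)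
  have "(Lp_norm \<Omega> 2 f)\<^sup>2 \<le> (\<integral>x. K\<^sup>2 * (norm (g x))\<^sup>2 \<partial>lebesgue_on \<Omega>)"
    unfolding Lp_norm_2_squared using f2 gi sq by (intro integral_mono) (auto simp: Lp_space_2_iff)
  also have "\<dots> = (K * Lp_norm \<Omega> 2 g)\<^sup>2"
    by (simp add: power_mult_distrib Lp_norm_2_squared)
  finally show "Lp_norm \<Omega> 2 f \<le> K * Lp_norm \<Omega> 2 g"
    by (rule power2_le_imp_le) (use K in \<open>simp add: Lp_norm_nonneg\<close>)
qed

lemma integrable_inner_Lp_space_2:
  assumes "f \<in> Lp_space \<Omega> 2" "g \<in> Lp_space \<Omega> 2"
  shows "integrable (lebesgue_on \<Omega>) (\<lambda>x. f x \<bullet> g x)"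
proof (rule Bochner_Integration.integrable_bound)
  show "integrable (lebesgue_on \<Omega>) (\<lambda>x. (norm (f x))\<^sup>2 + (norm (g x))\<^sup>2)"
    using assms by (simp add: Lp_space_2_iff)
  show "(\<lambda>x. f x \<bullet> g x) \<in> borel_measurable (lebesgue_on \<Omega>)"
    using assms by (auto simp: Lp_space_2_iff)
  have "\<bar>a \<bullet> b\<bar> \<le> (norm a)\<^sup>2 + (norm b)\<^sup>2" for a b :: 'b
    using Cauchy_Schwarz_ineq2[of a b] sum_squares_bound[of "norm a" "norm b"]
      mult_nonneg_nonneg[OF norm_ge_zero norm_ge_zero, of a b] by linarith
  then show "AE x in lebesgue_on \<Omega>. norm (f x \<bullet> g x) \<le> norm ((norm (f x))\<^sup>2 + (norm (g x))\<^sup>2)"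
    by simp
qed

text \<open>Expanding the square of \<open>l * norm e - norm w\<close> absorbs the mixed term into
  half of the coercive one. With these weights, integration gives the bound by
  \<open>norm w / l\<close> without loss.\<close>

lemma coercivity_with_perturbation:
  fixes e w :: "'a::real_inner"
  assumes "0 < l" "l \<le> k"
  shows "l / 2 * (norm e)\<^sup>2 - (norm w)\<^sup>2 / (2 * l) \<le> k * (norm e)\<^sup>2 + w \<bullet> e"
proof -
  have "0 \<le> (l * norm e - norm w)\<^sup>2 / (2 * l)" using assms by simp
  also have "\<dots> = l / 2 * (norm e)\<^sup>2 + (norm w)\<^sup>2 / (2 * l) - norm w * norm e"
    using assms by (simp add: field_simps power2_eq_square)
  finally have "- (l / 2 * (norm e)\<^sup>2 + (norm w)\<^sup>2 / (2 * l)) \<le> w \<bullet> e"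
    using Cauchy_Schwarz_ineq2[of w e] by linarith
  moreover have "l * (norm e)\<^sup>2 \<le> k * (norm e)\<^sup>2"
    using assms by (simp add: mult_right_mono)
  ultimately show ?thesis by (simp add: field_simps)
qed

lemma weak_solution_diff_estimate:
  assumes \<Omega>: "open \<Omega>" and \<kappa>: "continuous_on UNIV \<kappa>" "0 < \<kappa>\<^sub>l" "\<And>\<zeta>. \<kappa>\<^sub>l \<le> \<kappa> \<zeta> \<and> \<kappa> \<zeta> \<le> \<kappa>\<^sub>u"
    and z: "z\<^sub>1 \<in> borel_measurable (lebesgue_on \<Omega>)" "z\<^sub>2 \<in> borel_measurable (lebesgue_on \<Omega>)"
    and u: "weak_solution \<Omega> \<Gamma> \<kappa> z\<^sub>1 g u\<^sub>1" "weak_solution \<Omega> \<Gamma> \<kappa> z\<^sub>2 g u\<^sub>2"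
  defines "X \<equiv> Lp_norm \<Omega> 2 (\<lambda>x. (\<kappa> (z\<^sub>1 x) - \<kappa> (z\<^sub>2 x)) *\<^sub>R wgrad \<Omega> u\<^sub>2 x)"
  shows "Lp_norm \<Omega> 2 (wgrad \<Omega> (\<lambda>x. u\<^sub>1 x - u\<^sub>2 x)) \<le> X / \<kappa>\<^sub>l"
    and "Lp_norm \<Omega> 2 (\<lambda>x. \<kappa> (z\<^sub>1 x) *\<^sub>R wgrad \<Omega> u\<^sub>1 x - \<kappa> (z\<^sub>2 x) *\<^sub>R wgrad \<Omega> u\<^sub>2 x)
      \<le> 2 * (\<kappa>\<^sub>u / \<kappa>\<^sub>l + 1) * X"
proof -
  let ?M = "lebesgue_on \<Omega>"
  let ?a = "wgrad \<Omega> u\<^sub>1" and ?b = "wgrad \<Omega> u\<^sub>2" and ?e = "\<lambda>x. u\<^sub>1 x - u\<^sub>2 x"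
  let ?k1 = "\<lambda>x. \<kappa> (z\<^sub>1 x)" and ?k2 = "\<lambda>x. \<kappa> (z\<^sub>2 x)"
  let ?w = "\<lambda>x. (?k1 x - ?k2 x) *\<^sub>R ?b x"
  have u_in: "u\<^sub>1 \<in> H1D \<Omega> \<Gamma>" "u\<^sub>2 \<in> H1D \<Omega> \<Gamma>" "u\<^sub>1 \<in> H1 \<Omega>" "u\<^sub>2 \<in> H1 \<Omega>"
    using u by (auto simp: weak_solution_def H1D_def)
  have e_in: "?e \<in> H1D \<Omega> \<Gamma>" "?e \<in> H1 \<Omega>"
    using H1D_diff[OF \<Omega> u_in(1,2)] by (auto simp: H1D_def)
  have L2: "?a \<in> Lp_space \<Omega> 2" "?b \<in> Lp_space \<Omega> 2" "wgrad \<Omega> ?e \<in> Lp_space \<Omega> 2"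
    using u_in e_in by (auto intro: wgrad_in_Lp_space[OF \<Omega>])
  have e_AE: "AE x in ?M. wgrad \<Omega> ?e x = ?a x - ?b x"
    by (rule W1_space_2_diff[OF \<Omega> u_in(3,4)])
  have \<kappa>u: "0 \<le> \<kappa>\<^sub>u" using \<kappa>(2) \<kappa>(3)[of 0] by linarith
  have [measurable]: "?a \<in> borel_measurable ?M" "?b \<in> borel_measurable ?M"
    using L2 by (auto simp: Lp_space_2_iff)
  have [measurable]: "?k1 \<in> borel_measurable ?M" "?k2 \<in> borel_measurable ?M"
    using z borel_measurable_continuous_onI[OF \<kappa>(1)] by (auto intro: measurable_compose)
  \<comment> \<open>All values lie between 0 and the upper bound, so their differences obey the same
    bound as the values.\<close>
  have abs\<kappa>: "\<bar>\<kappa> \<zeta>\<bar> \<le> \<kappa>\<^sub>u" "\<bar>\<kappa> \<zeta> - \<kappa> \<xi>\<bar> \<le> \<kappa>\<^sub>u" for \<zeta> \<xi>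
    using \<kappa>(2) \<kappa>(3)[of \<zeta>] \<kappa>(3)[of \<xi>] by linarith+
  have flux: "(\<lambda>x. ?k1 x *\<^sub>R ?a x) \<in> Lp_space \<Omega> 2" "(\<lambda>x. ?k2 x *\<^sub>R ?b x) \<in> Lp_space \<Omega> 2"
    by (rule Lp_space_2_bound(1)[OF _ L2(1) \<kappa>u], measurable, simp add: abs\<kappa> mult_right_mono)
      (rule Lp_space_2_bound(1)[OF _ L2(2) \<kappa>u], measurable, simp add: abs\<kappa> mult_right_mono)
  have w: "?w \<in> Lp_space \<Omega> 2"
    by (rule Lp_space_2_bound(1)[OF _ L2(2) \<kappa>u], measurable, simp add: abs\<kappa> mult_right_mono)
  have "L2_inner \<Omega> (\<lambda>x. ?k1 x *\<^sub>R ?a x) (wgrad \<Omega> ?e) = L2_inner \<Omega> (\<lambda>x. ?k2 x *\<^sub>R ?b x) (wgrad \<Omega> ?e)"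
    using u e_in(1) by (simp add: weak_solution_def)
  \<comment> \<open>Both fluxes tested with the difference of the solutions give the same right-hand
    side; integrability allows the two integrals to be merged.\<close>
  then have orth: "(\<integral>x. (?k1 x *\<^sub>R ?a x - ?k2 x *\<^sub>R ?b x) \<bullet> wgrad \<Omega> ?e x \<partial>?M) = 0"
    unfolding L2_inner_def inner_diff_left
    using integrable_inner_Lp_space_2[OF flux(1) L2(3)] integrable_inner_Lp_space_2[OF flux(2) L2(3)]
    by simp
  have e2: "integrable ?M (\<lambda>x. \<kappa>\<^sub>l / 2 * (norm (wgrad \<Omega> ?e x))\<^sup>2)"
    using L2(3) unfolding Lp_space_2_iff by (intro integrable_mult_right) blast
  have w2: "integrable ?M (\<lambda>x. (norm (?w x))\<^sup>2 / (2 * \<kappa>\<^sub>l))"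
    using w unfolding Lp_space_2_iff by (intro integrable_divide) blast
  have "(\<integral>x. \<kappa>\<^sub>l / 2 * (norm (wgrad \<Omega> ?e x))\<^sup>2 - (norm (?w x))\<^sup>2 / (2 * \<kappa>\<^sub>l) \<partial>?M)
    \<le> (\<integral>x. (?k1 x *\<^sub>R ?a x - ?k2 x *\<^sub>R ?b x) \<bullet> wgrad \<Omega> ?e x \<partial>?M)"
  proof (rule integral_mono_AE)
    show "integrable ?M (\<lambda>x. \<kappa>\<^sub>l / 2 * (norm (wgrad \<Omega> ?e x))\<^sup>2 - (norm (?w x))\<^sup>2 / (2 * \<kappa>\<^sub>l))"
      by (rule Bochner_Integration.integrable_diff[OF e2 w2])
    show "integrable ?M (\<lambda>x. (?k1 x *\<^sub>R ?a x - ?k2 x *\<^sub>R ?b x) \<bullet> wgrad \<Omega> ?e x)"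
      by (rule integrable_inner_Lp_space_2[OF Lp_space_2_diff[OF flux] L2(3)])
    show "AE x in ?M. \<kappa>\<^sub>l / 2 * (norm (wgrad \<Omega> ?e x))\<^sup>2 - (norm (?w x))\<^sup>2 / (2 * \<kappa>\<^sub>l)
      \<le> (?k1 x *\<^sub>R ?a x - ?k2 x *\<^sub>R ?b x) \<bullet> wgrad \<Omega> ?e x"
      using e_AE
    proof eventually_elim
      case (elim x)
      \<comment> \<open>This splitting puts the whole change of the coefficient on the gradient of
        the second solution.\<close>
      have "?k1 x *\<^sub>R ?a x - ?k2 x *\<^sub>R ?b x = ?k1 x *\<^sub>R wgrad \<Omega> ?e x + ?w x"
        by (simp add: elim algebra_simps)
      then have "(?k1 x *\<^sub>R ?a x - ?k2 x *\<^sub>R ?b x) \<bullet> wgrad \<Omega> ?e x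
          = ?k1 x * (norm (wgrad \<Omega> ?e x))\<^sup>2 + ?w x \<bullet> wgrad \<Omega> ?e x"
        by (simp only: inner_add_left inner_scaleR_left power2_norm_eq_inner)
      then show ?case
        using coercivity_with_perturbation[of \<kappa>\<^sub>l "?k1 x" "wgrad \<Omega> ?e x" "?w x"] \<kappa> by simp
    qed
  qed
  also have "(\<integral>x. \<kappa>\<^sub>l / 2 * (norm (wgrad \<Omega> ?e x))\<^sup>2 - (norm (?w x))\<^sup>2 / (2 * \<kappa>\<^sub>l) \<partial>?M)
      = \<kappa>\<^sub>l / 2 * (Lp_norm \<Omega> 2 (wgrad \<Omega> ?e))\<^sup>2 - X\<^sup>2 / (2 * \<kappa>\<^sub>l)"
    unfolding X_def Lp_norm_2_squared Bochner_Integration.integral_diff[OF e2 w2]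
    by (simp only: integral_mult_right_zero integral_divide_zero)
  \<comment> \<open>The right-hand integral is 0 by \<open>orth\<close>; multiplying by twice the
    lower bound clears the denominators.\<close>
  finally have "(\<kappa>\<^sub>l * Lp_norm \<Omega> 2 (wgrad \<Omega> ?e))\<^sup>2 \<le> X\<^sup>2"
    using \<kappa>(2) by (simp add: orth field_simps power2_eq_square)
  then have "\<kappa>\<^sub>l * Lp_norm \<Omega> 2 (wgrad \<Omega> ?e) \<le> X"
    by (rule power2_le_imp_le) (simp add: X_def Lp_norm_nonneg)
  then show grad: "Lp_norm \<Omega> 2 (wgrad \<Omega> ?e) \<le> X / \<kappa>\<^sub>l"
    using \<kappa>(2) by (simp add: field_simps)
  let ?d = "\<lambda>x. ?a x - ?b x" and ?v = "\<lambda>x. (?k2 x - ?k1 x) *\<^sub>R ?b x"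
  have d: "?d \<in> Lp_space \<Omega> 2" by (rule Lp_space_2_diff[OF L2(1,2)])
  have kd: "(\<lambda>x. ?k1 x *\<^sub>R ?d x) \<in> Lp_space \<Omega> 2"
    "Lp_norm \<Omega> 2 (\<lambda>x. ?k1 x *\<^sub>R ?d x) \<le> \<kappa>\<^sub>u * Lp_norm \<Omega> 2 ?d"
    by (rule Lp_space_2_bound[OF _ d \<kappa>u], measurable, simp add: abs\<kappa> mult_right_mono)+
  have v: "?v \<in> Lp_space \<Omega> 2"
    by (rule Lp_space_2_bound(1)[OF _ L2(2) \<kappa>u], measurable, simp add: abs\<kappa> mult_right_mono)
  have v_norm: "Lp_norm \<Omega> 2 ?v = X"
    unfolding X_def Lp_norm_def by (simp add: abs_minus_commute)
  \<comment> \<open>The sign of \<open>?v\<close> is reversed relative to \<open>?w\<close> so that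
    the flux difference is literally a difference, as the squared triangle inequality requires; the
    norm is unaffected.\<close>
  have eq: "(\<lambda>x. ?k1 x *\<^sub>R ?a x - ?k2 x *\<^sub>R ?b x) = (\<lambda>x. ?k1 x *\<^sub>R ?d x - ?v x)"
    by (auto simp: algebra_simps)
  have X0: "0 \<le> X" by (simp add: X_def Lp_norm_nonneg)
  have "Lp_norm \<Omega> 2 (\<lambda>x. ?k1 x *\<^sub>R ?d x) \<le> \<kappa>\<^sub>u * (X / \<kappa>\<^sub>l)"
    using kd(2) mult_left_mono[OF grad \<kappa>u] by (simp add: Lp_norm_wgrad_diff[OF \<Omega> u_in(3,4)])
  then have "(Lp_norm \<Omega> 2 (\<lambda>x. ?k1 x *\<^sub>R ?d x))\<^sup>2 \<le> (\<kappa>\<^sub>u * (X / \<kappa>\<^sub>l))\<^sup>2"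
    by (intro power_mono Lp_norm_nonneg)
  with Lp_norm_2_diff_squared_le[OF kd(1) v]
  have "(Lp_norm \<Omega> 2 (\<lambda>x. ?k1 x *\<^sub>R ?a x - ?k2 x *\<^sub>R ?b x))\<^sup>2 \<le> 2 * (\<kappa>\<^sub>u * (X / \<kappa>\<^sub>l))\<^sup>2 + 2 * X\<^sup>2"
    unfolding eq v_norm by linarith
  also have "\<dots> \<le> (2 * (\<kappa>\<^sub>u * (X / \<kappa>\<^sub>l) + X))\<^sup>2"
  proof -
    have sq: "2 * x\<^sup>2 + 2 * y\<^sup>2 \<le> (2 * (x + y))\<^sup>2" if "0 \<le> x" "0 \<le> y" for x y :: real
      using that mult_nonneg_nonneg[OF that] by (simp add: power2_eq_square algebra_simps)
    show ?thesis by (rule sq) (use X0 \<kappa>u \<kappa>(2) in simp_all)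
  qed
  finally have "Lp_norm \<Omega> 2 (\<lambda>x. ?k1 x *\<^sub>R ?a x - ?k2 x *\<^sub>R ?b x) \<le> 2 * (\<kappa>\<^sub>u * (X / \<kappa>\<^sub>l) + X)"
    by (rule power2_le_imp_le) (use X0 \<kappa>u \<kappa>(2) in simp)
  then show "Lp_norm \<Omega> 2 (\<lambda>x. ?k1 x *\<^sub>R ?a x - ?k2 x *\<^sub>R ?b x) \<le> 2 * (\<kappa>\<^sub>u / \<kappa>\<^sub>l + 1) * X"
    by (simp add: algebra_simps)
qed

text \<open>The Gagliardo-Nirenberg inequality with exponents \<open>s\<close> and 2 leaves a power
  of the H1 norm, which the Poincare inequality replaces by the gradient norm.\<close>

lemma Lp_norm_le_gradient_interpolation:
  assumes gn: "gagliardo_nirenberg_constants \<Omega> C" and b\<^sub>0: "poincare_constant \<Omega> \<Gamma> b\<^sub>0"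
    and z: "z \<in> H1D \<Omega> \<Gamma>" and s: "s > 2"
  shows "z \<in> Lp_space \<Omega> s"
    and "Lp_norm \<Omega> s z \<le> \<bar>C s 2\<bar> * max 1 (1 / b\<^sub>0) *
      (Lp_norm \<Omega> 2 z powr (2 / s) * Lp_norm \<Omega> 2 (wgrad \<Omega> z) powr ((s - 2) / s))"
proof -
  have z1: "z \<in> H1 \<Omega>" using z by (simp add: H1D_def)
  have \<theta>: "0 \<le> (s - 2) / s" "(s - 2) / s \<le> 1" "1 - 2 / s = (s - 2) / s"
    using s by (auto simp: field_simps)
  show "z \<in> Lp_space \<Omega> s" 
    using gn z1 s unfolding gagliardo_nirenberg_constants_def
    by (metis less_imp_le one_le_numeral)
  have gn': "Lp_norm \<Omega> s z \<le> C s 2 * Lp_norm \<Omega> 2 z powr (2 / s) * H1_norm \<Omega> z powr (1 - 2 / s)"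
    using gn z1 s unfolding gagliardo_nirenberg_constants_def
    by (metis less_imp_le one_le_numeral)
  have b: "b\<^sub>0 > 0" "b\<^sub>0 * H1_norm \<Omega> z \<le> Lp_norm \<Omega> 2 (wgrad \<Omega> z)"
    using b\<^sub>0 z by (auto simp: poincare_constant_def)
  then have "H1_norm \<Omega> z \<le> (1 / b\<^sub>0) * Lp_norm \<Omega> 2 (wgrad \<Omega> z)"
    by (simp add: field_simps)
  also have "\<dots> \<le> max 1 (1 / b\<^sub>0) * Lp_norm \<Omega> 2 (wgrad \<Omega> z)"
    by (intro mult_right_mono Lp_norm_nonneg) simp
  finally have "H1_norm \<Omega> z powr ((s - 2) / s) \<le> (max 1 (1 / b\<^sub>0) * Lp_norm \<Omega> 2 (wgrad \<Omega> z)) powr ((s - 2) / s)"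
    using \<theta> by (intro powr_mono2 W1_norm_nonneg)
  also have "\<dots> = max 1 (1 / b\<^sub>0) powr ((s - 2) / s) * Lp_norm \<Omega> 2 (wgrad \<Omega> z) powr ((s - 2) / s)"
    by (intro powr_mult)
  \<comment> \<open>As the base is at least 1 and the exponent at most 1, the power is at most the
    base; this is the purpose of \<open>max\<close>, and it keeps \<open>s\<close> out of this
    factor.\<close>
  also have "\<dots> \<le> max 1 (1 / b\<^sub>0) * Lp_norm \<Omega> 2 (wgrad \<Omega> z) powr ((s - 2) / s)"
    using powr_mono[OF \<theta>(2), of "max 1 (1 / b\<^sub>0)"] by (intro mult_right_mono) auto
  finally have H: "H1_norm \<Omega> z powr ((s - 2) / s) \<le> \<dots>" .
  \<comment> \<open>The sign of \<open>C s 2\<close> is not prescribed; its absolute value makes the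
    later multiplication monotone.\<close>
  have "Lp_norm \<Omega> s z \<le> \<bar>C s 2\<bar> * Lp_norm \<Omega> 2 z powr (2 / s) * H1_norm \<Omega> z powr ((s - 2) / s)"
    using gn' unfolding \<theta>(3) by (rule order_trans) (intro mult_right_mono; simp)
  also have "\<dots> \<le> \<bar>C s 2\<bar> * Lp_norm \<Omega> 2 z powr (2 / s) *
      (max 1 (1 / b\<^sub>0) * Lp_norm \<Omega> 2 (wgrad \<Omega> z) powr ((s - 2) / s))"
    by (intro mult_left_mono H) simp
  finally show "Lp_norm \<Omega> s z \<le> \<bar>C s 2\<bar> * max 1 (1 / b\<^sub>0) *
      (Lp_norm \<Omega> 2 z powr (2 / s) * Lp_norm \<Omega> 2 (wgrad \<Omega> z) powr ((s - 2) / s))"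
    by (simp add: mult_ac)
qed

text \<open>The Lipschitz bound replaces the coefficient difference by
  \<open>z\<^sub>1 - z\<^sub>2\<close>, and Hoelder's inequality separates it from the gradient. The
  factor 2 comes from passing to the Sobolev norm of \<open>u\<close>.\<close>

lemma conductivity_difference_estimate:
  assumes \<Omega>: "open \<Omega>" and b\<^sub>0: "poincare_constant \<Omega> \<Gamma> b\<^sub>0"
    and gn: "gagliardo_nirenberg_constants \<Omega> C\<^sub>g\<^sub>n" and \<kappa>: "continuous_on UNIV \<kappa>"
    and lip: "\<And>\<zeta>\<^sub>1 \<zeta>\<^sub>2. \<bar>\<kappa> \<zeta>\<^sub>1 - \<kappa> \<zeta>\<^sub>2\<bar> \<le> L * \<bar>\<zeta>\<^sub>1 - \<zeta>\<^sub>2\<bar>"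
    and rs: "r > 2" "1 / r + 1 / s = 1 / 2"
    and z: "z\<^sub>1 \<in> H1D \<Omega> \<Gamma>" "z\<^sub>2 \<in> H1D \<Omega> \<Gamma>" and u: "u \<in> W1_space \<Omega> r"
  shows "Lp_norm \<Omega> 2 (\<lambda>x. (\<kappa> (z\<^sub>1 x) - \<kappa> (z\<^sub>2 x)) *\<^sub>R wgrad \<Omega> u x)
    \<le> 2 * L * \<bar>C\<^sub>g\<^sub>n s 2\<bar> * max 1 (1 / b\<^sub>0) * W1_norm \<Omega> r u
      * (Lp_norm \<Omega> 2 (\<lambda>x. z\<^sub>1 x - z\<^sub>2 x) powr (2 / s)
      * Lp_norm \<Omega> 2 (wgrad \<Omega> (\<lambda>x. z\<^sub>1 x - z\<^sub>2 x)) powr ((s - 2) / s))"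
proof -
  let ?z = "\<lambda>x. z\<^sub>1 x - z\<^sub>2 x"
  let ?I = "Lp_norm \<Omega> 2 ?z powr (2 / s) * Lp_norm \<Omega> 2 (wgrad \<Omega> ?z) powr ((s - 2) / s)"
  have L: "L \<ge> 0" using lip[of 1 0] by simp
  \<comment> \<open>The range of \<open>s\<close> is read off from its reciprocal; strict positivity
    of \<open>1 / s\<close> also excludes \<open>s = 0\<close>, where the reciprocal is 0 by
    convention.\<close>
  have inv: "1 / s = 1 / 2 - 1 / r" "0 < 1 / r" "1 / r < 1 / 2"
    using rs by (auto simp: field_simps)
  then have "1 / s > 0" "1 / s < 1 / 2" by linarith+
  then have s: "s > 2" by (simp add: field_simps zero_less_divide_iff)
  have zs: "?z \<in> Lp_space \<Omega> s" "Lp_norm \<Omega> s ?z \<le> \<bar>C\<^sub>g\<^sub>n s 2\<bar> * max 1 (1 / b\<^sub>0) * ?I"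
    by (rule Lp_norm_le_gradient_interpolation[OF gn b\<^sub>0 H1D_diff[OF \<Omega> z] s])+
  have zu: "(\<lambda>x. ?z x *\<^sub>R wgrad \<Omega> u x) \<in> Lp_space \<Omega> 2"
    "Lp_norm \<Omega> 2 (\<lambda>x. ?z x *\<^sub>R wgrad \<Omega> u x) \<le> Lp_norm \<Omega> s ?z * Lp_norm \<Omega> r (wgrad \<Omega> u)"
    by (rule Lp_norm_scaleR_le[OF rs(1) s rs(2) zs(1) wgrad_in_Lp_space[OF \<Omega> u]])+
  have z_meas: "z\<^sub>1 \<in> borel_measurable (lebesgue_on \<Omega>)" "z\<^sub>2 \<in> borel_measurable (lebesgue_on \<Omega>)"
    using z by (auto simp: H1D_def W1_space_def Lp_space_def)
  have [measurable]: "(\<lambda>x. \<kappa> (z\<^sub>1 x)) \<in> borel_measurable (lebesgue_on \<Omega>)"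
    "(\<lambda>x. \<kappa> (z\<^sub>2 x)) \<in> borel_measurable (lebesgue_on \<Omega>)"
    using z_meas borel_measurable_continuous_onI[OF \<kappa>] by (auto intro: measurable_compose)
  have [measurable]: "wgrad \<Omega> u \<in> borel_measurable (lebesgue_on \<Omega>)"
    by (rule wgrad_measurable[OF \<Omega> u])
  have "Lp_norm \<Omega> 2 (\<lambda>x. (\<kappa> (z\<^sub>1 x) - \<kappa> (z\<^sub>2 x)) *\<^sub>R wgrad \<Omega> u x)
      \<le> L * Lp_norm \<Omega> 2 (\<lambda>x. ?z x *\<^sub>R wgrad \<Omega> u x)"
  proof (rule Lp_space_2_bound(2)[OF _ zu(1) L])
    show "norm ((\<kappa> (z\<^sub>1 x) - \<kappa> (z\<^sub>2 x)) *\<^sub>R wgrad \<Omega> u x) \<le> L * norm (?z x *\<^sub>R wgrad \<Omega> u x)" for x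
      using mult_right_mono[OF lip[of "z\<^sub>1 x" "z\<^sub>2 x"], of "norm (wgrad \<Omega> u x)"] by (simp add: mult.assoc)
  qed measurable
  also have "\<dots> \<le> L * ((\<bar>C\<^sub>g\<^sub>n s 2\<bar> * max 1 (1 / b\<^sub>0) * ?I) * (2 * W1_norm \<Omega> r u))"
  proof (rule mult_left_mono[OF _ L])
    have "Lp_norm \<Omega> s ?z * Lp_norm \<Omega> r (wgrad \<Omega> u)
      \<le> (\<bar>C\<^sub>g\<^sub>n s 2\<bar> * max 1 (1 / b\<^sub>0) * ?I) * (2 * W1_norm \<Omega> r u)"
      using rs(1) by (intro mult_mono zs(2) Lp_norm_wgrad_le_W1_norm[OF \<Omega> u] Lp_norm_nonneg
          mult_nonneg_nonneg) auto
    with zu(2) show "Lp_norm \<Omega> 2 (\<lambda>x. ?z x *\<^sub>R wgrad \<Omega> u x)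
      \<le> (\<bar>C\<^sub>g\<^sub>n s 2\<bar> * max 1 (1 / b\<^sub>0) * ?I) * (2 * W1_norm \<Omega> r u)" by linarith
  qed
  finally show ?thesis by (simp add: mult_ac)
qed

section \<open>Stability of gradients and fluxes, with one constant for both\<close>

theorem lemma2:
  shows "\<exists>C\<^sub>w :: real \<Rightarrow> real \<Rightarrow> real \<Rightarrow> real \<Rightarrow> real \<Rightarrow> real.
    \<forall>(\<Omega> :: (real^2) set) \<Gamma>\<^sub>D \<Gamma>\<^sub>N (\<kappa> :: real \<Rightarrow> real) \<kappa>\<^sub>l \<kappa>\<^sub>u L\<^sub>\<kappa> b\<^sub>0 C\<^sub>g\<^sub>n r\<^sub>0 C r s g.
      open \<Omega> \<and> bounded \<Omega> \<and> lipschitz_boundary \<Omega> \<and>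
      frontier \<Omega> = \<Gamma>\<^sub>D \<union> \<Gamma>\<^sub>N \<and> \<Gamma>\<^sub>D \<inter> \<Gamma>\<^sub>N = {} \<and> \<Gamma>\<^sub>D \<noteq> {} \<and>
      poincare_constant \<Omega> \<Gamma>\<^sub>D b\<^sub>0 \<and>
      gagliardo_nirenberg_constants \<Omega> C\<^sub>g\<^sub>n \<and>
      continuous_on UNIV \<kappa> \<and> bounded (range \<kappa>) \<and>
      0 < \<kappa>\<^sub>l \<and> (\<forall>\<zeta>. \<kappa>\<^sub>l \<le> \<kappa> \<zeta> \<and> \<kappa> \<zeta> \<le> \<kappa>\<^sub>u) \<and>
      (\<forall>\<zeta>\<^sub>1 \<zeta>\<^sub>2. \<bar>\<kappa> \<zeta>\<^sub>1 - \<kappa> \<zeta>\<^sub>2\<bar> \<le> L\<^sub>\<kappa> * \<bar>\<zeta>\<^sub>1 - \<zeta>\<^sub>2\<bar>) \<and>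
      meyers_constants \<Omega> \<Gamma>\<^sub>D \<kappa> r\<^sub>0 C \<and>
      g \<in> Lp_space \<Omega> 2 \<and>
      2 < r \<and> ereal r < r\<^sub>0 \<and> 1 / r + 1 / s = 1 / 2
      \<longrightarrow>
      (\<forall>z\<^sub>1 \<in> H1D \<Omega> \<Gamma>\<^sub>D. \<forall>z\<^sub>2 \<in> H1D \<Omega> \<Gamma>\<^sub>D. \<forall>u\<^sub>1 u\<^sub>2.
         weak_solution \<Omega> \<Gamma>\<^sub>D \<kappa> z\<^sub>1 g u\<^sub>1 \<and> weak_solution \<Omega> \<Gamma>\<^sub>D \<kappa> z\<^sub>2 g u\<^sub>2 \<longrightarrow>
         Lp_norm \<Omega> 2 (wgrad \<Omega> (\<lambda>x. u\<^sub>1 x - u\<^sub>2 x))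
           \<le> C\<^sub>w \<kappa>\<^sub>l \<kappa>\<^sub>u L\<^sub>\<kappa> b\<^sub>0 (C\<^sub>g\<^sub>n s 2) * C r * Lp_norm \<Omega> 2 g
             * Lp_norm \<Omega> 2 (\<lambda>x. z\<^sub>1 x - z\<^sub>2 x) powr (2 / s)
             * Lp_norm \<Omega> 2 (wgrad \<Omega> (\<lambda>x. z\<^sub>1 x - z\<^sub>2 x)) powr ((s - 2) / s) \<and>
         Lp_norm \<Omega> 2 (\<lambda>x. \<kappa> (z\<^sub>1 x) *\<^sub>R wgrad \<Omega> u\<^sub>1 x - \<kappa> (z\<^sub>2 x) *\<^sub>R wgrad \<Omega> u\<^sub>2 x)
           \<le> C\<^sub>w \<kappa>\<^sub>l \<kappa>\<^sub>u L\<^sub>\<kappa> b\<^sub>0 (C\<^sub>g\<^sub>n s 2) * C r * Lp_norm \<Omega> 2 g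
             * Lp_norm \<Omega> 2 (\<lambda>x. z\<^sub>1 x - z\<^sub>2 x) powr (2 / s)
             * Lp_norm \<Omega> 2 (wgrad \<Omega> (\<lambda>x. z\<^sub>1 x - z\<^sub>2 x)) powr ((s - 2) / s))"
proof -
  \<comment> \<open>\<open>A\<close> collects the constants of the coefficient perturbation.
    \<open>F\<close> is the sum of the constants of the gradient and flux estimates, hence dominates
    each. Both are fixed before the domain and the data, and \<open>s\<close> enters only through
    the value \<open>c\<close> of the Gagliardo-Nirenberg constant.\<close>
  define A where "A L b c = 2 * L * \<bar>c\<bar> * max 1 (1 / b)" for L b c :: real
  define F where "F kl ku = 1 / kl + 2 * (ku / kl + 1)" for kl ku :: real
  let ?C\<^sub>w = "\<lambda>kl ku L b c. F kl ku * A L b c"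
  have est: "Lp_norm \<Omega> 2 (wgrad \<Omega> (\<lambda>x. u\<^sub>1 x - u\<^sub>2 x)) \<le> ?C\<^sub>w \<kappa>\<^sub>l \<kappa>\<^sub>u L b\<^sub>0 (C\<^sub>g\<^sub>n s 2) * C r * Lp_norm \<Omega> 2 g
        * Lp_norm \<Omega> 2 (\<lambda>x. z\<^sub>1 x - z\<^sub>2 x) powr (2 / s)
        * Lp_norm \<Omega> 2 (wgrad \<Omega> (\<lambda>x. z\<^sub>1 x - z\<^sub>2 x)) powr ((s - 2) / s) \<and>
      Lp_norm \<Omega> 2 (\<lambda>x. \<kappa> (z\<^sub>1 x) *\<^sub>R wgrad \<Omega> u\<^sub>1 x - \<kappa> (z\<^sub>2 x) *\<^sub>R wgrad \<Omega> u\<^sub>2 x)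
        \<le> ?C\<^sub>w \<kappa>\<^sub>l \<kappa>\<^sub>u L b\<^sub>0 (C\<^sub>g\<^sub>n s 2) * C r * Lp_norm \<Omega> 2 g
        * Lp_norm \<Omega> 2 (\<lambda>x. z\<^sub>1 x - z\<^sub>2 x) powr (2 / s)
        * Lp_norm \<Omega> 2 (wgrad \<Omega> (\<lambda>x. z\<^sub>1 x - z\<^sub>2 x)) powr ((s - 2) / s)"
    if \<Omega>: "open \<Omega>" and b\<^sub>0: "poincare_constant \<Omega> \<Gamma> b\<^sub>0"
      and gn: "gagliardo_nirenberg_constants \<Omega> C\<^sub>g\<^sub>n"
      and \<kappa>: "continuous_on UNIV \<kappa>" "0 < \<kappa>\<^sub>l" "\<And>\<zeta>. \<kappa>\<^sub>l \<le> \<kappa> \<zeta> \<and> \<kappa> \<zeta> \<le> \<kappa>\<^sub>u"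
      and lip: "\<And>\<zeta>\<^sub>1 \<zeta>\<^sub>2. \<bar>\<kappa> \<zeta>\<^sub>1 - \<kappa> \<zeta>\<^sub>2\<bar> \<le> L * \<bar>\<zeta>\<^sub>1 - \<zeta>\<^sub>2\<bar>"
      and meyers: "meyers_constants \<Omega> \<Gamma> \<kappa> r\<^sub>0 C" and g: "g \<in> Lp_space \<Omega> 2"
      and r: "2 < r" "ereal r < r\<^sub>0" "1 / r + 1 / s = 1 / 2"
      and z: "z\<^sub>1 \<in> H1D \<Omega> \<Gamma>" "z\<^sub>2 \<in> H1D \<Omega> \<Gamma>"
      and u: "weak_solution \<Omega> \<Gamma> \<kappa> z\<^sub>1 g u\<^sub>1" "weak_solution \<Omega> \<Gamma> \<kappa> z\<^sub>2 g u\<^sub>2"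
    for \<Omega> \<Gamma> :: "(real^2) set" and \<kappa> :: "real \<Rightarrow> real" and \<kappa>\<^sub>l \<kappa>\<^sub>u L b\<^sub>0 C\<^sub>g\<^sub>n r\<^sub>0 C r s g z\<^sub>1 z\<^sub>2 u\<^sub>1 u\<^sub>2
  proof -
    let ?X = "Lp_norm \<Omega> 2 (\<lambda>x. (\<kappa> (z\<^sub>1 x) - \<kappa> (z\<^sub>2 x)) *\<^sub>R wgrad \<Omega> u\<^sub>2 x)"
    let ?I = "Lp_norm \<Omega> 2 (\<lambda>x. z\<^sub>1 x - z\<^sub>2 x) powr (2 / s)
      * Lp_norm \<Omega> 2 (wgrad \<Omega> (\<lambda>x. z\<^sub>1 x - z\<^sub>2 x)) powr ((s - 2) / s)"
    have L: "L \<ge> 0" using lip[of 1 0] by simp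
    have \<kappa>u: "\<kappa>\<^sub>u \<ge> 0" using \<kappa>(2) \<kappa>(3)[of 0] by linarith
    have zm: "z\<^sub>1 \<in> borel_measurable (lebesgue_on \<Omega>)" "z\<^sub>2 \<in> borel_measurable (lebesgue_on \<Omega>)"
      using z by (auto simp: H1D_def W1_space_def Lp_space_def)
    \<comment> \<open>Only the second solution needs higher integrability, since only its gradient
      multiplies the coefficient difference.\<close>
    have u2: "u\<^sub>2 \<in> W1_space \<Omega> r" "W1_norm \<Omega> r u\<^sub>2 \<le> C r * Lp_norm \<Omega> 2 g"
      using meyers r zm(2) g u(2) unfolding meyers_constants_def by (meson less_imp_le)+
    have A0: "0 \<le> A L b\<^sub>0 (C\<^sub>g\<^sub>n s 2)" using L by (simp add: A_def)
    have "?X \<le> A L b\<^sub>0 (C\<^sub>g\<^sub>n s 2) * W1_norm \<Omega> r u\<^sub>2 * ?I"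
      unfolding A_def by (rule conductivity_difference_estimate[OF \<Omega> b\<^sub>0 gn \<kappa>(1) lip r(1,3) z u2(1)])
    also have "\<dots> \<le> A L b\<^sub>0 (C\<^sub>g\<^sub>n s 2) * (C r * Lp_norm \<Omega> 2 g) * ?I"
      using A0 by (intro mult_right_mono mult_left_mono u2(2)) auto
    finally have X: "?X \<le> A L b\<^sub>0 (C\<^sub>g\<^sub>n s 2) * (C r * Lp_norm \<Omega> 2 g) * ?I" .
    have F0: "0 \<le> F \<kappa>\<^sub>l \<kappa>\<^sub>u" "1 / \<kappa>\<^sub>l \<le> F \<kappa>\<^sub>l \<kappa>\<^sub>u" "2 * (\<kappa>\<^sub>u / \<kappa>\<^sub>l + 1) \<le> F \<kappa>\<^sub>l \<kappa>\<^sub>u"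
      using \<kappa>(2) \<kappa>u by (simp_all add: F_def)
    \<comment> \<open>Both left-hand sides are at most \<open>F\<close> times \<open>?X\<close>, so
      this single bound finishes both estimates.\<close>
    have "F \<kappa>\<^sub>l \<kappa>\<^sub>u * ?X \<le> F \<kappa>\<^sub>l \<kappa>\<^sub>u * (A L b\<^sub>0 (C\<^sub>g\<^sub>n s 2) * (C r * Lp_norm \<Omega> 2 g) * ?I)"
      by (rule mult_left_mono[OF X F0(1)])
    also have "\<dots> = ?C\<^sub>w \<kappa>\<^sub>l \<kappa>\<^sub>u L b\<^sub>0 (C\<^sub>g\<^sub>n s 2) * C r * Lp_norm \<Omega> 2 g
        * Lp_norm \<Omega> 2 (\<lambda>x. z\<^sub>1 x - z\<^sub>2 x) powr (2 / s)
        * Lp_norm \<Omega> 2 (wgrad \<Omega> (\<lambda>x. z\<^sub>1 x - z\<^sub>2 x)) powr ((s - 2) / s)"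
      by (simp only: mult.assoc)
    finally have FX: "F \<kappa>\<^sub>l \<kappa>\<^sub>u * ?X \<le> \<dots>" .
    have "Lp_norm \<Omega> 2 (wgrad \<Omega> (\<lambda>x. u\<^sub>1 x - u\<^sub>2 x)) \<le> F \<kappa>\<^sub>l \<kappa>\<^sub>u * ?X"
      using weak_solution_diff_estimate(1)[OF \<Omega> \<kappa> zm u]
        mult_right_mono[OF F0(2) Lp_norm_nonneg[of \<Omega> 2 "\<lambda>x. (\<kappa> (z\<^sub>1 x) - \<kappa> (z\<^sub>2 x)) *\<^sub>R wgrad \<Omega> u\<^sub>2 x"]]
      by simp
    moreover have "Lp_norm \<Omega> 2 (\<lambda>x. \<kappa> (z\<^sub>1 x) *\<^sub>R wgrad \<Omega> u\<^sub>1 x - \<kappa> (z\<^sub>2 x) *\<^sub>R wgrad \<Omega> u\<^sub>2 x) \<le> F \<kappa>\<^sub>l \<kappa>\<^sub>u * ?X"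
      using weak_solution_diff_estimate(2)[OF \<Omega> \<kappa> zm u]
        mult_right_mono[OF F0(3) Lp_norm_nonneg[of \<Omega> 2 "\<lambda>x. (\<kappa> (z\<^sub>1 x) - \<kappa> (z\<^sub>2 x)) *\<^sub>R wgrad \<Omega> u\<^sub>2 x"]]
      by simp
    ultimately show ?thesis using FX by (meson order_trans)
  qed
  show ?thesis
  proof (intro exI[of _ ?C\<^sub>w] allI impI ballI, goal_cases)
    case (1 \<Omega> \<Gamma>\<^sub>D \<Gamma>\<^sub>N \<kappa> \<kappa>\<^sub>l \<kappa>\<^sub>u L\<^sub>\<kappa> b\<^sub>0 C\<^sub>g\<^sub>n r\<^sub>0 C r s g z\<^sub>1 z\<^sub>2 u\<^sub>1 u\<^sub>2)
    show ?case
      by (rule est[where \<Omega> = \<Omega> and \<Gamma> = \<Gamma>\<^sub>D and \<kappa> = \<kappa> and L = L\<^sub>\<kappa> and b\<^sub>0 = b\<^sub>0 and C\<^sub>g\<^sub>n = C\<^sub>g\<^sub>n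
            and \<kappa>\<^sub>l = \<kappa>\<^sub>l and \<kappa>\<^sub>u = \<kappa>\<^sub>u and r\<^sub>0 = r\<^sub>0 and C = C and r = r and s = s and g = g
            and z\<^sub>1 = z\<^sub>1 and z\<^sub>2 = z\<^sub>2 and u\<^sub>1 = u\<^sub>1 and u\<^sub>2 = u\<^sub>2])
        (use 1 in simp_all)
  qed
qed

end
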